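(* Let $(X,d)$ be a metric space such that the transportation cost space $\mathrm{TC}(X)$ contains a linear subspace that is linearly isometric to $\ell_1$. Then $\mathrm{TC}(X)$ contains a $1$-complemented linear subspace that is linearly isometric to $\ell_1$; that is, there exist a closed linear subspace $L\subseteq \mathrm{TC}(X)$ linearly isometric to $\ell_1$ and a bounded linear projection $P:\mathrm{TC}(X)\to \mathrm{TC}(X)$ with $P^2=P$, range equal to $L$, and $\|P\|=1$.
   Context: All vector spaces are real, and $\ell_1$ is the space of absolutely summable real sequences indexed by $\mathbb{N}$ with its usual norm. Let $(X,d)$ be a metric space and let $\mathbf{1}_u:X\to\mathbb{R}$ denote the indicator function of a point $u\in X$. A transportation problem on $X$ is a finitely supported function $f:X\to\mathbb{R}$ with $\sum_{v\in \mathrm{supp} f} f(v)=0$; $\mathrm{TP}(X)$ is the real vector space of all transportation problems on $X$. A transportation plan for $f\in \mathrm{TP}(X)$ is a representation $f=\sum_{i=1}^n a_i(\mathbf{1}_{x_i}-\mathbf{1}_{y_i})$ with $a_i\ge 0$ and $x_i,y_i\in X$, and its cost is $\sum_{i=1}^n a_i d(x_i,y_i)$. The transportation cost norm $\|f\|_{\mathrm{TC}}$ is the infimum of the costs of all transportation plans for $f$. The transportation cost space $\mathrm{TC}(X)$ (also known as the Lipschitz-free space or Arens-Eells space) is the completion of $(\mathrm{TP}(X),\|\cdot\|_{\mathrm{TC}})$. *)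

theory Defs
  imports "HOL-Analysis.Analysis"
begin

typedef 'a tp = "{f :: 'a \<Rightarrow> real. finite {v. f v \<noteq> 0} \<and> (\<Sum>v\<in>{v. f v \<noteq> 0}. f v) = 0}"
  morphisms tp_fun Abs_tp
  by (rule exI[of _ "\<lambda>_. 0"]) simp

setup_lifting type_definition_tp

lemma finite_supp_tp: "finite {v. tp_fun f v \<noteq> 0}"
  using tp_fun[of f] by simp

lemma sum_tp_superset:
  assumes "finite A" "{v. tp_fun f v \<noteq> 0} \<subseteq> A"
  shows "sum (tp_fun f) A = 0"
proof -
  have "sum (tp_fun f) {v. tp_fun f v \<noteq> 0} = sum (tp_fun f) A"
    by (rule sum.mono_neutral_left) (use assms in auto)
  thus ?thesis using tp_fun[of f] by simp
qed

lemma tp_memI: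
  assumes "finite A" "\<And>v. v \<notin> A \<Longrightarrow> f v = 0" "sum f A = (0::real)"
  shows "finite {v. f v \<noteq> 0} \<and> (\<Sum>v\<in>{v. f v \<noteq> 0}. f v) = 0"
proof
  have sub: "{v. f v \<noteq> 0} \<subseteq> A" using assms(2) by auto
  show "finite {v. f v \<noteq> 0}" using sub assms(1) by (rule finite_subset)
  have "sum f {v. f v \<noteq> 0} = sum f A"
    by (rule sum.mono_neutral_left) (use assms sub in auto)
  thus "(\<Sum>v\<in>{v. f v \<noteq> 0}. f v) = 0" using assms(3) by simp
qed

instantiation tp :: (type) real_vector
begin

lift_definition zero_tp :: "'a tp" is "\<lambda>_. 0" by simp

lift_definition plus_tp :: "'a tp \<Rightarrow> 'a tp \<Rightarrow> 'a tp" is "\<lambda>f g v. f v + g v"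
proof -
  fix f g :: "'a \<Rightarrow> real"
  assume "finite {v. f v \<noteq> 0} \<and> (\<Sum>v\<in>{v. f v \<noteq> 0}. f v) = 0"
    and "finite {v. g v \<noteq> 0} \<and> (\<Sum>v\<in>{v. g v \<noteq> 0}. g v) = 0"
  then obtain F G where F: "tp_fun F = f" and G: "tp_fun G = g"
    by (metis (mono_tags, lifting) Abs_tp_inverse mem_Collect_eq)
  define A where "A = {v. f v \<noteq> 0} \<union> {v. g v \<noteq> 0}"
  have A: "finite A"
    using finite_supp_tp[of F] finite_supp_tp[of G] by (simp add: A_def F G)
  have "sum f A = 0" "sum g A = 0"
    using sum_tp_superset[OF A, of F] sum_tp_superset[OF A, of G] by (auto simp: F G A_def)
  thus "finite {v. f v + g v \<noteq> 0} \<and> (\<Sum>v\<in>{v. f v + g v \<noteq> 0}. f v + g v) = 0"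
    by (intro tp_memI[OF A]) (auto simp: A_def sum.distrib)
qed

lift_definition scaleR_tp :: "real \<Rightarrow> 'a tp \<Rightarrow> 'a tp" is "\<lambda>c f v. c * f v"
proof -
  fix f :: "'a \<Rightarrow> real" and c :: real
  assume f: "finite {v. f v \<noteq> 0} \<and> (\<Sum>v\<in>{v. f v \<noteq> 0}. f v) = 0"
  show "finite {v. c * f v \<noteq> 0} \<and> (\<Sum>v\<in>{v. c * f v \<noteq> 0}. c * f v) = 0"
    by (rule tp_memI[of "{v. f v \<noteq> 0}"]) (use f in \<open>auto simp: sum_distrib_left[symmetric]\<close>)
qed

definition uminus_tp :: "'a tp \<Rightarrow> 'a tp" where "uminus_tp f = (-1) *\<^sub>R f"
definition minus_tp :: "'a tp \<Rightarrow> 'a tp \<Rightarrow> 'a tp" where "minus_tp f g = f + (-1) *\<^sub>R g"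

instance
proof
  fix f g h :: "'a tp" and a b :: real
  show "f + g + h = f + (g + h)" by transfer (simp add: add.assoc)
  show "f + g = g + f" by transfer (simp add: add.commute)
  show "0 + f = f" by transfer simp
  show "- f + f = 0" unfolding uminus_tp_def by transfer simp
  show "f - g = f + - g" by (simp add: uminus_tp_def minus_tp_def)
  show "a *\<^sub>R (f + g) = a *\<^sub>R f + a *\<^sub>R g" by transfer (simp add: algebra_simps)
  show "(a + b) *\<^sub>R f = a *\<^sub>R f + b *\<^sub>R f" by transfer (simp add: algebra_simps)
  show "a *\<^sub>R b *\<^sub>R f = (a * b) *\<^sub>R f" by transfer (simp add: algebra_simps)
  show "1 *\<^sub>R f = f" by transfer simp
qed

end

text \<open>An entry \<open>(a, x, y)\<close> stands for the summand \<open>a (1_x - 1_y)\<close>.\<close>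

definition plan_sum :: "(real \<times> 'a \<times> 'a) list \<Rightarrow> 'a \<Rightarrow> real" where
  "plan_sum p v = (\<Sum>(a, x, y)\<leftarrow>p. a * (indicator {x} v - indicator {y} v))"

definition transport_plan :: "(real \<times> 'a \<times> 'a) list \<Rightarrow> 'a tp \<Rightarrow> bool" where
  "transport_plan p f \<longleftrightarrow> (\<forall>(a, x, y)\<in>set p. 0 \<le> a) \<and> tp_fun f = plan_sum p"

definition plan_cost :: "(real \<times> 'a::metric_space \<times> 'a) list \<Rightarrow> real" where
  "plan_cost p = (\<Sum>(a, x, y)\<leftarrow>p. a * dist x y)"

definition tc_norm :: "'a::metric_space tp \<Rightarrow> real" where
  "tc_norm f = (INF p\<in>{p. transport_plan p f}. plan_cost p)"

lemma plan_cost_nonneg: "transport_plan p f \<Longrightarrow> 0 \<le> plan_cost p"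
  unfolding transport_plan_def plan_cost_def by (fastforce intro!: sum_list_nonneg)

lemma plan_sum_append: "plan_sum (p @ q) v = plan_sum p v + plan_sum q v"
  by (simp add: plan_sum_def)

lemma transport_plan_append:
  "transport_plan p f \<Longrightarrow> transport_plan q g \<Longrightarrow> transport_plan (p @ q) (f + g)"
  unfolding transport_plan_def by (auto simp: plus_tp.rep_eq plan_sum_append fun_eq_iff)

lemma transport_plan_scale:
  assumes "transport_plan p f" "0 \<le> c"
  shows "transport_plan (map (\<lambda>(a, x, y). (c * a, x, y)) p) (c *\<^sub>R f)"
proof -
  have "plan_sum (map (\<lambda>(a, x, y). (c * a, x, y)) p) v = c * plan_sum p v" for v
    unfolding plan_sum_def by (induction p) (auto simp: algebra_simps)
  thus ?thesis using assms unfolding transport_plan_def by (auto simp: scaleR_tp.rep_eq fun_eq_iff)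
qed

lemma plan_cost_scale: "plan_cost (map (\<lambda>(a, x, y). (c * a, x, y)) p) = c * plan_cost p"
  unfolding plan_cost_def by (induction p) (auto simp: algebra_simps)

lemma transport_plan_swap:
  assumes "transport_plan p f"
  shows "transport_plan (map (\<lambda>(a, x, y). (a, y, x)) p) (- f)"
proof -
  have "plan_sum (map (\<lambda>(a, x, y). (a, y, x)) p) v = - plan_sum p v" for v
    unfolding plan_sum_def by (induction p) (auto simp: algebra_simps)
  moreover have "tp_fun (- f) v = - tp_fun f v" for v
    unfolding uminus_tp_def scaleR_tp.rep_eq by simp
  ultimately show ?thesis using assms unfolding transport_plan_def by (auto simp: fun_eq_iff)
qed

lemma plan_cost_swap: "plan_cost (map (\<lambda>(a, x, y). (a, y, x)) p) = plan_cost p"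
  unfolding plan_cost_def by (induction p) (auto simp: dist_commute)

lemma transport_plan_exists: "\<exists>p. transport_plan p f"
proof -
  define b :: 'a where "b = undefined"
  obtain vs where vs: "set vs = {v. tp_fun f v \<noteq> 0}" "distinct vs"
    using finite_distinct_list[OF finite_supp_tp] by metis
  define e where "e v = (if tp_fun f v \<ge> 0 then (tp_fun f v, v, b) else (- tp_fun f v, b, v))" for v
  have "plan_sum (map e vs) v = tp_fun f v" for v
  proof -
    have "plan_sum (map e vs) v
        = (\<Sum>w\<leftarrow>vs. tp_fun f w * (indicator {w} v - indicator {b} v))"
      unfolding plan_sum_def map_map o_def
      by (rule arg_cong[where f = sum_list], rule map_cong) (auto simp: e_def algebra_simps)
    also have "\<dots> = (\<Sum>w\<in>set vs. tp_fun f w * (indicator {w} v - indicator {b} v))"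
      using vs(2) by (simp add: sum_list_distinct_conv_sum_set)
    also have "\<dots> = (\<Sum>w\<in>set vs. tp_fun f w * indicator {w} v) - (\<Sum>w\<in>set vs. tp_fun f w) * indicator {b} v"
      by (simp only: right_diff_distrib sum_subtractf sum_distrib_right)
    also have "(\<Sum>w\<in>set vs. tp_fun f w) = 0" by (rule sum_tp_superset) (simp_all add: vs(1) finite_supp_tp)
    also have "(\<Sum>w\<in>set vs. tp_fun f w * indicator {w} v) = (\<Sum>w\<in>set vs. if v = w then tp_fun f w else 0)"
      by (rule sum.cong) (auto simp: indicator_def)
    also have "\<dots> = (if v \<in> set vs then tp_fun f v else 0)"
      by (rule sum.delta'[OF finite_set])
    also have "\<dots> = tp_fun f v" using vs(1) by simp
    finally show ?thesis by simp
  qed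
  hence "transport_plan (map e vs) f" by (auto simp: transport_plan_def e_def fun_eq_iff)
  thus ?thesis by blast
qed

lemma bdd_below_plan_cost: "bdd_below (plan_cost ` {p. transport_plan p f})"
  by (rule bdd_belowI[of _ 0]) (auto intro: plan_cost_nonneg)

lemma tc_norm_le: "transport_plan p f \<Longrightarrow> tc_norm f \<le> plan_cost p"
  unfolding tc_norm_def by (rule cINF_lower[OF bdd_below_plan_cost]) auto

lemma tc_norm_ge: "(\<And>p. transport_plan p f \<Longrightarrow> c \<le> plan_cost p) \<Longrightarrow> c \<le> tc_norm f"
  unfolding tc_norm_def by (rule cINF_greatest) (use transport_plan_exists[of f] in auto)

text \<open>The easy half of Kantorovich duality.\<close>

lemma plan_cost_dual:
  assumes g: "\<And>x y. \<bar>g x - g y\<bar> \<le> dist x y" and p: "transport_plan p f"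
    and A: "finite A" "{v. tp_fun f v \<noteq> 0} \<subseteq> A"
  shows "\<bar>\<Sum>v\<in>A. tp_fun f v * g v\<bar> \<le> plan_cost p"
proof -
  define B where "B = A \<union> (\<Union>(a, x, y)\<in>set p. {x, y})"
  have B: "finite B" using A by (auto simp: B_def)
  have *: "(\<Sum>v\<in>B. plan_sum q v * g v) = (\<Sum>(a, x, y)\<leftarrow>q. a * (g x - g y))"
    if "set q \<subseteq> set p" for q
    using that
  proof (induction q)
    case (Cons e q)
    obtain a x y where e: "e = (a, x, y)" by (cases e)
    have "x \<in> B" "y \<in> B" using Cons.prems by (auto simp: B_def e)
    have ind: "(\<Sum>v\<in>B. indicator {z} v * g v) = g z" if "z \<in> B" for z
    proof -
      have "(\<Sum>v\<in>B. indicator {z} v * g v) = (\<Sum>v\<in>B. if z = v then g v else 0)"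
        by (rule sum.cong) (auto simp: indicator_def)
      thus ?thesis using that B by simp
    qed
    have "(\<Sum>v\<in>B. plan_sum (e # q) v * g v)
        = (\<Sum>v\<in>B. a * (indicator {x} v * g v) - a * (indicator {y} v * g v) + plan_sum q v * g v)"
      by (rule sum.cong) (auto simp: plan_sum_def e algebra_simps)
    also have "\<dots> = a * (g x - g y) + (\<Sum>v\<in>B. plan_sum q v * g v)"
      by (simp only: sum.distrib sum_subtractf sum_distrib_left[symmetric]
            ind[OF \<open>x \<in> B\<close>] ind[OF \<open>y \<in> B\<close>] right_diff_distrib)
    finally show ?case using Cons by (simp add: e)
  qed (simp add: plan_sum_def)
  have "(\<Sum>v\<in>A. tp_fun f v * g v) = (\<Sum>v\<in>B. tp_fun f v * g v)"
    by (rule sum.mono_neutral_left) (use A B in \<open>auto simp: B_def\<close>)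
  also have "\<dots> = (\<Sum>(a, x, y)\<leftarrow>p. a * (g x - g y))"
    using *[of p] p by (simp add: transport_plan_def)
  also have "\<bar>\<dots>\<bar> \<le> (\<Sum>(a, x, y)\<leftarrow>p. \<bar>a * (g x - g y)\<bar>)"
    using sum_list_abs[of "map (\<lambda>(a, x, y). a * (g x - g y)) p"]
    by (simp add: o_def case_prod_unfold)
  also have "\<dots> \<le> plan_cost p"
    unfolding plan_cost_def
  proof (rule sum_list_mono)
    fix e assume e: "e \<in> set p"
    obtain a x y where [simp]: "e = (a, x, y)" by (cases e)
    have "0 \<le> a" using p e by (auto simp: transport_plan_def)
    thus "(case e of (a, x, y) \<Rightarrow> \<bar>a * (g x - g y)\<bar>) \<le> (case e of (a, x, y) \<Rightarrow> a * dist x y)"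
      using g[of x y] by (simp add: abs_mult mult_left_mono)
  qed
  finally show ?thesis .
qed

lemma tc_norm_pos:
  fixes f :: "'a::metric_space tp"
  assumes "f \<noteq> 0"
  shows "0 < tc_norm f"
proof -
  define S where "S = {v. tp_fun f v \<noteq> 0}"
  have S: "finite S" unfolding S_def by (rule finite_supp_tp)
  obtain u where u: "tp_fun f u \<noteq> 0"
  proof -
    have "tp_fun f \<noteq> (\<lambda>_. 0)"
      using assms tp_fun_inject[of f 0] by (simp add: zero_tp.rep_eq)
    thus ?thesis using that by (auto simp: fun_eq_iff)
  qed
  have ne: "S - {u} \<noteq> {}"
  proof
    assume "S - {u} = {}"
    hence "S = {u}" using u by (auto simp: S_def)
    hence "tp_fun f u = 0" using sum_tp_superset[of S f] S by (simp add: S_def)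
    thus False using u by simp
  qed
  define g where "g x = infdist x (S - {u})" for x
  have lip: "\<bar>g x - g y\<bar> \<le> dist x y" for x y
    unfolding g_def using infdist_triangle_abs by blast
  have "closed (S - {u})" using S by (simp add: finite_imp_closed)
  hence "g u > 0" unfolding g_def using ne
    using in_closed_iff_infdist_zero[of "S - {u}" u] infdist_nonneg[of u "S - {u}"] by auto
  have "(\<Sum>v\<in>S. tp_fun f v * g v) = (\<Sum>v\<in>{u}. tp_fun f v * g v)"
    by (rule sum.mono_neutral_right) (use S u in \<open>auto simp: S_def g_def\<close>)
  hence "\<bar>tp_fun f u * g u\<bar> \<le> tc_norm f"
    using plan_cost_dual[OF lip _ S, of _ f] by (intro tc_norm_ge) (simp add: S_def)
  moreover have "\<bar>tp_fun f u * g u\<bar> > 0" using u \<open>g u > 0\<close> by simp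
  ultimately show ?thesis by linarith
qed

lemma tc_norm_zero: "tc_norm (0 :: 'a::metric_space tp) = 0"
proof (rule antisym)
  have "transport_plan [] (0 :: 'a tp)"
    by (simp add: transport_plan_def zero_tp.rep_eq plan_sum_def fun_eq_iff)
  from tc_norm_le[OF this] show "tc_norm (0 :: 'a tp) \<le> 0" by (simp add: plan_cost_def)
qed (intro tc_norm_ge plan_cost_nonneg)

lemma tc_norm_triangle: "tc_norm (f + g) \<le> tc_norm f + tc_norm g"
proof -
  have "tc_norm (f + g) - tc_norm g \<le> tc_norm f"
  proof (rule tc_norm_ge)
    fix p assume p: "transport_plan p f"
    have "tc_norm (f + g) - plan_cost p \<le> tc_norm g"
    proof (rule tc_norm_ge)
      fix q assume "transport_plan q g"
      from tc_norm_le[OF transport_plan_append[OF p this]]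
      show "tc_norm (f + g) - plan_cost p \<le> plan_cost q" by (simp add: plan_cost_def)
    qed
    thus "tc_norm (f + g) - tc_norm g \<le> plan_cost p" by simp
  qed
  thus ?thesis by simp
qed

lemma tc_norm_uminus: "tc_norm (- f) = tc_norm f"
proof -
  have "tc_norm (- h) \<le> tc_norm h" for h :: "'a tp"
  proof (rule tc_norm_ge)
    fix p assume "transport_plan p h"
    from tc_norm_le[OF transport_plan_swap[OF this]] show "tc_norm (- h) \<le> plan_cost p"
      by (simp add: plan_cost_swap)
  qed
  from this[of f] this[of "- f"] show ?thesis by simp
qed

lemma tc_norm_scaleR: "tc_norm (c *\<^sub>R f) = \<bar>c\<bar> * tc_norm f"
proof -
  have le: "tc_norm (k *\<^sub>R h) \<le> k * tc_norm h" if k: "k > 0" for k and h :: "'a tp"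
  proof -
    have "tc_norm (k *\<^sub>R h) / k \<le> tc_norm h"
    proof (rule tc_norm_ge)
      fix p assume "transport_plan p h"
      from tc_norm_le[OF transport_plan_scale[OF this less_imp_le[OF k]]]
      have "tc_norm (k *\<^sub>R h) \<le> k * plan_cost p" by (simp only: plan_cost_scale)
      thus "tc_norm (k *\<^sub>R h) / k \<le> plan_cost p"
        using k by (simp add: pos_divide_le_eq mult.commute)
    qed
    thus ?thesis using k by (simp add: pos_divide_le_eq mult.commute)
  qed
  have eq: "tc_norm (k *\<^sub>R h) = k * tc_norm h" if k: "k > 0" for k and h :: "'a tp"
  proof (rule antisym[OF le[OF k]])
    have "tc_norm (inverse k *\<^sub>R (k *\<^sub>R h)) \<le> inverse k * tc_norm (k *\<^sub>R h)"
      by (rule le) (use k in simp)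
    hence "k * tc_norm h \<le> k * (inverse k * tc_norm (k *\<^sub>R h))"
      using k by (intro mult_left_mono) simp_all
    also have "\<dots> = tc_norm (k *\<^sub>R h)" using k by simp
    finally show "k * tc_norm h \<le> tc_norm (k *\<^sub>R h)" .
  qed
  consider "c > 0" | "c = 0" | "c < 0" by linarith
  thus ?thesis
  proof cases
    case 1
    thus ?thesis by (simp add: eq[OF 1])
  next
    case 2
    thus ?thesis by (simp add: tc_norm_zero)
  next
    case 3
    have "tc_norm (c *\<^sub>R f) = tc_norm ((- c) *\<^sub>R f)"
      using tc_norm_uminus[of "c *\<^sub>R f"] by simp
    also have "\<dots> = \<bar>c\<bar> * tc_norm f" using 3 eq[of "- c" f] by simp
    finally show ?thesis .
  qed
qed

instantiation tp :: (metric_space) real_normed_vector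
begin

definition norm_tp :: "'a tp \<Rightarrow> real" where "norm_tp = tc_norm"
definition sgn_tp :: "'a tp \<Rightarrow> 'a tp" where "sgn_tp f = f /\<^sub>R norm f"
definition dist_tp :: "'a tp \<Rightarrow> 'a tp \<Rightarrow> real" where "dist_tp f g = norm (f - g)"
definition uniformity_tp :: "('a tp \<times> 'a tp) filter" where
  "uniformity_tp = (INF e\<in>{0<..}. principal {(f, g). dist f g < e})"
definition open_tp :: "'a tp set \<Rightarrow> bool" where
  "open_tp U = (\<forall>f\<in>U. \<forall>\<^sub>F (f', g) in uniformity. f' = f \<longrightarrow> g \<in> U)"

instance
proof
  fix f g :: "'a tp" and c :: real
  show "norm f = 0 \<longleftrightarrow> f = 0"
    unfolding norm_tp_def using tc_norm_pos[of f] tc_norm_zero by (metis less_irrefl)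
  show "norm (f + g) \<le> norm f + norm g"
    unfolding norm_tp_def by (rule tc_norm_triangle)
  show "norm (c *\<^sub>R f) = \<bar>c\<bar> * norm f"
    unfolding norm_tp_def by (rule tc_norm_scaleR)
qed (rule sgn_tp_def dist_tp_def uniformity_tp_def open_tp_def)+

end

definition cauchy_rel :: "(nat \<Rightarrow> 'a::real_normed_vector) \<Rightarrow> (nat \<Rightarrow> 'a) \<Rightarrow> bool" where
  "cauchy_rel s t \<longleftrightarrow> Cauchy s \<and> Cauchy t \<and> (\<lambda>n. s n - t n) \<longlonglongrightarrow> 0"

lemma cauchy_rel_refl: "Cauchy s \<Longrightarrow> cauchy_rel s s"
  by (simp add: cauchy_rel_def)

lemma Cauchy_const_seq [simp]: "Cauchy (\<lambda>_. c :: 'a::real_normed_vector)"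
  by (rule LIMSEQ_imp_Cauchy[OF tendsto_const])

lemma Cauchy_norm_iff:
  fixes s :: "nat \<Rightarrow> 'a::real_normed_vector"
  shows "Cauchy s \<longleftrightarrow> (\<forall>e>0. \<exists>M. \<forall>m\<ge>M. \<forall>n\<ge>M. norm (s m - s n) < e)"
  unfolding Cauchy_def dist_norm ..

lemma Cauchy_add_seq:
  fixes s t :: "nat \<Rightarrow> 'a::real_normed_vector"
  assumes "Cauchy s" "Cauchy t"
  shows "Cauchy (\<lambda>n. s n + t n)"
  unfolding Cauchy_norm_iff
proof (intro allI impI)
  fix e :: real assume "e > 0"
  hence e2: "e / 2 > 0" by simp
  obtain M where M: "\<forall>m\<ge>M. \<forall>n\<ge>M. norm (s m - s n) < e / 2"
    using assms(1) e2 unfolding Cauchy_norm_iff by blast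
  obtain N where N: "\<forall>m\<ge>N. \<forall>n\<ge>N. norm (t m - t n) < e / 2"
    using assms(2) e2 unfolding Cauchy_norm_iff by blast
  have "norm (s m + t m - (s n + t n)) < e" if "m \<ge> max M N" "n \<ge> max M N" for m n
  proof -
    have "norm (s m + t m - (s n + t n)) \<le> norm (s m - s n) + norm (t m - t n)"
      by (rule norm_diff_triangle_ineq)
    also have "\<dots> < e / 2 + e / 2" using M N that by (intro add_strict_mono) auto
    finally show ?thesis by simp
  qed
  thus "\<exists>M. \<forall>m\<ge>M. \<forall>n\<ge>M. norm (s m + t m - (s n + t n)) < e" by blast
qed

lemma Cauchy_scaleR_seq:
  fixes s :: "nat \<Rightarrow> 'a::real_normed_vector"
  shows "Cauchy s \<Longrightarrow> Cauchy (\<lambda>n. c *\<^sub>R s n)"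
  by (rule bounded_linear.Cauchy[OF bounded_linear_scaleR_right])

lemma Cauchy_norm_seq:
  fixes s :: "nat \<Rightarrow> 'a::real_normed_vector"
  assumes "Cauchy s"
  shows "Cauchy (\<lambda>n. norm (s n))"
  unfolding Cauchy_norm_iff
proof (intro allI impI)
  fix e :: real assume "e > 0"
  then obtain M where "\<forall>m\<ge>M. \<forall>n\<ge>M. norm (s m - s n) < e"
    using assms unfolding Cauchy_norm_iff by blast
  hence "\<forall>m\<ge>M. \<forall>n\<ge>M. norm (norm (s m) - norm (s n)) < e"
    by (auto intro: order_le_less_trans[OF norm_triangle_ineq3])
  thus "\<exists>M. \<forall>m\<ge>M. \<forall>n\<ge>M. norm (norm (s m) - norm (s n)) < e" by blast
qed

quotient_type (overloaded) 'a completion = "nat \<Rightarrow> 'a::real_normed_vector" / partial: cauchy_rel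
proof (rule part_equivpI)
  show "\<exists>s :: nat \<Rightarrow> 'a. cauchy_rel s s" by (rule exI[of _ "\<lambda>_. 0"]) (simp add: cauchy_rel_def)
  show "symp (cauchy_rel :: (nat \<Rightarrow> 'a) \<Rightarrow> _)"
  proof (rule sympI)
    fix s t :: "nat \<Rightarrow> 'a" assume "cauchy_rel s t"
    thus "cauchy_rel t s"
      using tendsto_minus[of "\<lambda>n. s n - t n" 0] by (simp add: cauchy_rel_def)
  qed
  show "transp (cauchy_rel :: (nat \<Rightarrow> 'a) \<Rightarrow> _)"
  proof (rule transpI)
    fix r s t :: "nat \<Rightarrow> 'a" assume "cauchy_rel r s" "cauchy_rel s t"
    thus "cauchy_rel r t"
      using tendsto_add[of "\<lambda>n. r n - s n" 0 _ "\<lambda>n. s n - t n" 0] by (simp add: cauchy_rel_def)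
  qed
qed

instantiation completion :: (real_normed_vector) real_vector
begin

lift_definition zero_completion :: "'a completion" is "\<lambda>_. 0" by (simp add: cauchy_rel_def)

lift_definition plus_completion :: "'a completion \<Rightarrow> 'a completion \<Rightarrow> 'a completion"
  is "\<lambda>s t n. s n + t n"
proof -
  fix s s' t t' :: "nat \<Rightarrow> 'a"
  assume "cauchy_rel s s'" "cauchy_rel t t'"
  thus "cauchy_rel (\<lambda>n. s n + t n) (\<lambda>n. s' n + t' n)"
    using tendsto_add[of "\<lambda>n. s n - s' n" 0 _ "\<lambda>n. t n - t' n" 0]
    by (simp add: cauchy_rel_def Cauchy_add_seq algebra_simps)
qed

lift_definition scaleR_completion :: "real \<Rightarrow> 'a completion \<Rightarrow> 'a completion"
  is "\<lambda>c s n. c *\<^sub>R s n"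
proof -
  fix s t :: "nat \<Rightarrow> 'a" and c :: real
  assume "cauchy_rel s t"
  thus "cauchy_rel (\<lambda>n. c *\<^sub>R s n) (\<lambda>n. c *\<^sub>R t n)"
    using tendsto_scaleR[OF tendsto_const[of c], of "\<lambda>n. s n - t n" 0]
    by (simp add: cauchy_rel_def Cauchy_scaleR_seq scaleR_diff_right)
qed

definition uminus_completion :: "'a completion \<Rightarrow> 'a completion" where
  "uminus_completion x = (-1) *\<^sub>R x"
definition minus_completion :: "'a completion \<Rightarrow> 'a completion \<Rightarrow> 'a completion" where
  "minus_completion x y = x + (-1) *\<^sub>R y"

instance
proof
  fix x y z :: "'a completion" and a b :: real
  show "x + y + z = x + (y + z)"
    by transfer (simp add: cauchy_rel_def Cauchy_add_seq add.assoc)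
  show "x + y = y + x"
    by transfer (simp add: cauchy_rel_def Cauchy_add_seq add.commute)
  show "0 + x = x" by transfer (simp add: cauchy_rel_def)
  show "- x + x = 0" unfolding uminus_completion_def
    by transfer (simp add: cauchy_rel_def)
  show "x - y = x + - y" by (simp add: uminus_completion_def minus_completion_def)
  show "a *\<^sub>R (x + y) = a *\<^sub>R x + a *\<^sub>R y"
    by transfer (simp add: cauchy_rel_def Cauchy_add_seq Cauchy_scaleR_seq scaleR_add_right)
  show "(a + b) *\<^sub>R x = a *\<^sub>R x + b *\<^sub>R x"
    by transfer (simp add: cauchy_rel_def Cauchy_add_seq Cauchy_scaleR_seq scaleR_add_left)
  show "a *\<^sub>R b *\<^sub>R x = (a * b) *\<^sub>R x"
    by transfer (simp add: cauchy_rel_def Cauchy_scaleR_seq)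
  show "1 *\<^sub>R x = x" by transfer (simp add: cauchy_rel_def)
qed

end

lemma cauchy_rel_lim_norm:
  assumes "cauchy_rel s t"
  shows "lim (\<lambda>n. norm (s n)) = lim (\<lambda>n. norm (t n))"
proof -
  have "convergent (\<lambda>n. norm (t n))"
    using assms by (simp add: cauchy_rel_def Cauchy_norm_seq Cauchy_convergent)
  hence t: "(\<lambda>n. norm (t n)) \<longlonglongrightarrow> lim (\<lambda>n. norm (t n))" by (simp add: convergent_LIMSEQ_iff)
  have "(\<lambda>n. norm (s n) - norm (t n)) \<longlonglongrightarrow> 0"
  proof (rule Lim_null_comparison)
    show "\<forall>\<^sub>F n in sequentially. norm (norm (s n) - norm (t n)) \<le> norm (s n - t n)"
      by (simp add: norm_triangle_ineq3)
    show "(\<lambda>n. norm (s n - t n)) \<longlonglongrightarrow> 0"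
      using assms by (auto simp: cauchy_rel_def intro: tendsto_norm_zero)
  qed
  from tendsto_add[OF this t] show ?thesis by (simp add: limI)
qed

instantiation completion :: (real_normed_vector) real_normed_vector
begin

lift_definition norm_completion :: "'a completion \<Rightarrow> real" is "\<lambda>s. lim (\<lambda>n. norm (s n))"
  by (rule cauchy_rel_lim_norm)

definition sgn_completion :: "'a completion \<Rightarrow> 'a completion" where
  "sgn_completion x = x /\<^sub>R norm x"
definition dist_completion :: "'a completion \<Rightarrow> 'a completion \<Rightarrow> real" where
  "dist_completion x y = norm (x - y)"
definition uniformity_completion :: "('a completion \<times> 'a completion) filter" where
  "uniformity_completion = (INF e\<in>{0<..}. principal {(x, y). dist x y < e})"
definition open_completion :: "'a completion set \<Rightarrow> bool" where
  "open_completion U = (\<forall>x\<in>U. \<forall>\<^sub>F (x', y) in uniformity. x' = x \<longrightarrow> y \<in> U)"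

lemma Cauchy_LIMSEQ_norm:
  fixes s :: "nat \<Rightarrow> 'b::real_normed_vector"
  shows "Cauchy s \<Longrightarrow> (\<lambda>n. norm (s n)) \<longlonglongrightarrow> lim (\<lambda>n. norm (s n))"
  by (simp add: Cauchy_norm_seq Cauchy_convergent flip: convergent_LIMSEQ_iff)

instance
proof
  fix x y :: "'a completion" and c :: real
  show "norm x = 0 \<longleftrightarrow> x = 0"
  proof (transfer, rule iffI)
    fix s :: "nat \<Rightarrow> 'a"
    assume "cauchy_rel s s" "lim (\<lambda>n. norm (s n)) = 0"
    thus "cauchy_rel s (\<lambda>_. 0)"
      using Cauchy_LIMSEQ_norm[of s] by (simp add: cauchy_rel_def tendsto_norm_zero_iff)
  next
    fix s :: "nat \<Rightarrow> 'a"
    assume "cauchy_rel s (\<lambda>_. 0)"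
    from cauchy_rel_lim_norm[OF this] show "lim (\<lambda>n. norm (s n)) = 0" by simp
  qed
  show "norm (x + y) \<le> norm x + norm y"
  proof transfer
    fix s t :: "nat \<Rightarrow> 'a"
    assume "cauchy_rel s s" "cauchy_rel t t"
    hence st: "Cauchy s" "Cauchy t" by (simp_all add: cauchy_rel_def)
    show "lim (\<lambda>n. norm (s n + t n)) \<le> lim (\<lambda>n. norm (s n)) + lim (\<lambda>n. norm (t n))"
      by (rule LIMSEQ_le[OF Cauchy_LIMSEQ_norm[OF Cauchy_add_seq[OF st]]
            tendsto_add[OF Cauchy_LIMSEQ_norm[OF st(1)] Cauchy_LIMSEQ_norm[OF st(2)]]])
        (simp add: norm_triangle_ineq)
  qed
  show "norm (c *\<^sub>R x) = \<bar>c\<bar> * norm x"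
  proof transfer
    fix s :: "nat \<Rightarrow> 'a" and c :: real
    assume "cauchy_rel s s"
    hence "Cauchy s" by (simp add: cauchy_rel_def)
    from tendsto_mult_left[OF Cauchy_LIMSEQ_norm[OF this], of "\<bar>c\<bar>"]
    show "lim (\<lambda>n. norm (c *\<^sub>R s n)) = \<bar>c\<bar> * lim (\<lambda>n. norm (s n))" by (simp add: limI)
  qed
qed (rule sgn_completion_def dist_completion_def uniformity_completion_def open_completion_def)+

end

lift_definition to_completion :: "'a::real_normed_vector \<Rightarrow> 'a completion" is "\<lambda>x _. x"
  by (simp add: cauchy_rel_def)

lemma linear_to_completion: "linear to_completion"
proof
  fix x y :: 'a and c :: real
  show "to_completion (x + y) = to_completion x + to_completion y"
    by transfer (simp add: cauchy_rel_def)
  show "to_completion (c *\<^sub>R x) = c *\<^sub>R to_completion x"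
    by transfer (simp add: cauchy_rel_def)
qed

lemma norm_to_completion: "norm (to_completion x) = norm x"
  by transfer simp

lemma norm_diff_abs_completion:
  assumes "Cauchy s" "Cauchy t"
  shows "norm (abs_completion s - abs_completion t) = lim (\<lambda>n. norm (s n - t n))"
    and "Cauchy (\<lambda>n. s n - t n)"
proof -
  have t: "Cauchy (\<lambda>n. (- 1) *\<^sub>R t n)" by (rule Cauchy_scaleR_seq[OF assms(2)])
  show c: "Cauchy (\<lambda>n. s n - t n)" using Cauchy_add_seq[OF assms(1) t] by simp
  have "abs_completion s - abs_completion t = abs_completion (\<lambda>n. s n + (- 1) *\<^sub>R t n)"
    unfolding minus_completion_def
    by (simp only: plus_completion.abs_eq scaleR_completion.abs_eq cauchy_rel_refl assms t)
  thus "norm (abs_completion s - abs_completion t) = lim (\<lambda>n. norm (s n - t n))"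
    using c by (simp add: norm_completion.abs_eq cauchy_rel_refl)
qed

lemma to_completion_approx:
  fixes x :: "'a::real_normed_vector completion"
  assumes e: "0 < e"
  shows "\<exists>a. norm (x - to_completion a) < e"
proof -
  obtain s where x: "x = abs_completion s" and s: "Cauchy s"
    by (induction x rule: completion.abs_induct) (auto simp: cauchy_rel_def)
  obtain M where M: "\<forall>m\<ge>M. \<forall>n\<ge>M. norm (s m - s n) < e / 2"
    using s half_gt_zero[OF e] unfolding Cauchy_norm_iff by blast
  have const: "Cauchy (\<lambda>_::nat. s M)" by simp
  from Cauchy_LIMSEQ_norm[OF norm_diff_abs_completion(2)[OF s const]]
  have "lim (\<lambda>n. norm (s n - s M)) \<le> e / 2"
    by (rule Lim_bounded[where M = M]) (use M in \<open>auto intro: less_imp_le\<close>)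
  hence "norm (x - to_completion (s M)) < e"
    using e by (simp add: x to_completion_def norm_diff_abs_completion(1)[OF s const])
  thus ?thesis ..
qed

lemma dense_to_completion: "closure (range to_completion) = (UNIV :: 'a::real_normed_vector completion set)"
proof -
  have "x \<in> closure (range to_completion)" for x :: "'a completion"
    unfolding closure_approachable using to_completion_approx[of _ x]
    by (auto simp: dist_norm norm_minus_commute)
  thus ?thesis by blast
qed

lemma to_completion_Cauchy_LIMSEQ:
  assumes "Cauchy s"
  shows "(\<lambda>n. to_completion (s n)) \<longlonglongrightarrow> abs_completion s"
proof (rule LIMSEQ_I)
  fix e :: real assume "0 < e"
  obtain M where M: "\<forall>m\<ge>M. \<forall>n\<ge>M. norm (s m - s n) < e / 2"
    using assms half_gt_zero[OF \<open>0 < e\<close>] unfolding Cauchy_norm_iff by blast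
  have "norm (to_completion (s m) - abs_completion s) < e" if "m \<ge> M" for m
  proof -
    have const: "Cauchy (\<lambda>_::nat. s m)" by simp
    have "norm (to_completion (s m) - abs_completion s) = lim (\<lambda>n. norm (s m - s n))"
      by (simp add: to_completion_def norm_diff_abs_completion(1)[OF const assms])
    moreover from Cauchy_LIMSEQ_norm[OF norm_diff_abs_completion(2)[OF const assms]]
    have "lim (\<lambda>n. norm (s m - s n)) \<le> e / 2"
      by (rule Lim_bounded[where M = M]) (use M that in \<open>auto intro: less_imp_le\<close>)
    ultimately show ?thesis using \<open>0 < e\<close> by simp
  qed
  thus "\<exists>M. \<forall>m\<ge>M. norm (to_completion (s m) - abs_completion s) < e" by blast
qed

instance completion :: (real_normed_vector) banach
proof
  fix X :: "nat \<Rightarrow> 'a completion"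
  assume X: "Cauchy X"
  have "\<exists>a. norm (X n - to_completion a) < 1 / real (Suc n)" for n
    by (rule to_completion_approx) simp
  then obtain s where s: "\<And>n. norm (X n - to_completion (s n)) < 1 / real (Suc n)" by metis
  have null: "(\<lambda>n. to_completion (s n) - X n) \<longlonglongrightarrow> 0"
  proof (rule Lim_null_comparison)
    show "\<forall>\<^sub>F n in sequentially. norm (to_completion (s n) - X n) \<le> 1 / real (Suc n)"
      using s by (simp add: norm_minus_commute less_imp_le)
    show "(\<lambda>n. 1 / real (Suc n)) \<longlonglongrightarrow> 0"
      using LIMSEQ_inverse_real_of_nat by (simp add: inverse_eq_divide)
  qed
  have "Cauchy (\<lambda>n. to_completion (s n))"
    using Cauchy_add_seq[OF X LIMSEQ_imp_Cauchy[OF null]] by simp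
  hence "Cauchy s"
    unfolding Cauchy_norm_iff
    by (simp add: norm_to_completion flip: linear_diff[OF linear_to_completion])
  from tendsto_diff[OF to_completion_Cauchy_LIMSEQ[OF this] null]
  show "convergent X" by (auto simp: convergent_def)
qed

type_synonym 'a tc = "'a tp completion"

typedef ell1 = "{x :: nat \<Rightarrow> real. summable (\<lambda>n. \<bar>x n\<bar>)}"
  morphisms ell1_seq Abs_ell1
  by (rule exI[of _ "\<lambda>_. 0"]) simp

setup_lifting type_definition_ell1

lemma summable_ell1: "summable (\<lambda>n. \<bar>ell1_seq x n\<bar>)"
  using ell1_seq[of x] by simp

instantiation ell1 :: real_vector
begin

lift_definition zero_ell1 :: ell1 is "\<lambda>_. 0" by simp

lift_definition plus_ell1 :: "ell1 \<Rightarrow> ell1 \<Rightarrow> ell1" is "\<lambda>x y n. x n + y n"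
proof -
  fix x y :: "nat \<Rightarrow> real"
  assume "summable (\<lambda>n. \<bar>x n\<bar>)" "summable (\<lambda>n. \<bar>y n\<bar>)"
  hence "summable (\<lambda>n. \<bar>x n\<bar> + \<bar>y n\<bar>)" by (rule summable_add)
  thus "summable (\<lambda>n. \<bar>x n + y n\<bar>)"
    by (rule summable_comparison_test[rotated]) (simp add: abs_triangle_ineq)
qed

lift_definition scaleR_ell1 :: "real \<Rightarrow> ell1 \<Rightarrow> ell1" is "\<lambda>c x n. c * x n"
  by (simp add: abs_mult summable_mult)

definition uminus_ell1 :: "ell1 \<Rightarrow> ell1" where "uminus_ell1 x = (-1) *\<^sub>R x"
definition minus_ell1 :: "ell1 \<Rightarrow> ell1 \<Rightarrow> ell1" where "minus_ell1 x y = x + (-1) *\<^sub>R y"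

instance
proof
  fix x y z :: ell1 and a b :: real
  show "x + y + z = x + (y + z)" by transfer (simp add: add.assoc)
  show "x + y = y + x" by transfer (simp add: add.commute)
  show "0 + x = x" by transfer simp
  show "- x + x = 0" unfolding uminus_ell1_def by transfer simp
  show "x - y = x + - y" by (simp add: uminus_ell1_def minus_ell1_def)
  show "a *\<^sub>R (x + y) = a *\<^sub>R x + a *\<^sub>R y" by transfer (simp add: algebra_simps)
  show "(a + b) *\<^sub>R x = a *\<^sub>R x + b *\<^sub>R x" by transfer (simp add: algebra_simps)
  show "a *\<^sub>R b *\<^sub>R x = (a * b) *\<^sub>R x" by transfer (simp add: algebra_simps)
  show "1 *\<^sub>R x = x" by transfer simp
qed

end

instantiation ell1 :: real_normed_vector
begin

lift_definition norm_ell1 :: "ell1 \<Rightarrow> real" is "\<lambda>x. \<Sum>n. \<bar>x n\<bar>" .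

definition sgn_ell1 :: "ell1 \<Rightarrow> ell1" where "sgn_ell1 x = x /\<^sub>R norm x"
definition dist_ell1 :: "ell1 \<Rightarrow> ell1 \<Rightarrow> real" where "dist_ell1 x y = norm (x - y)"
definition uniformity_ell1 :: "(ell1 \<times> ell1) filter" where
  "uniformity_ell1 = (INF e\<in>{0<..}. principal {(x, y). dist x y < e})"
definition open_ell1 :: "ell1 set \<Rightarrow> bool" where
  "open_ell1 U = (\<forall>x\<in>U. \<forall>\<^sub>F (x', y) in uniformity. x' = x \<longrightarrow> y \<in> U)"

instance
proof
  fix x y :: ell1 and c :: real
  show "norm x = 0 \<longleftrightarrow> x = 0"
    by transfer (auto simp: suminf_eq_zero_iff fun_eq_iff)
  show "norm (x + y) \<le> norm x + norm y"
  proof -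
    have "(\<Sum>n. \<bar>ell1_seq (x + y) n\<bar>) \<le> (\<Sum>n. \<bar>ell1_seq x n\<bar> + \<bar>ell1_seq y n\<bar>)"
      by (rule suminf_le)
        (auto simp: plus_ell1.rep_eq abs_triangle_ineq summable_add summable_ell1
              intro: summable_ell1[of "x + y", unfolded plus_ell1.rep_eq])
    thus ?thesis by (simp add: norm_ell1.rep_eq suminf_add summable_ell1)
  qed
  show "norm (c *\<^sub>R x) = \<bar>c\<bar> * norm x"
    by transfer (simp add: abs_mult suminf_mult)
qed (rule sgn_ell1_def dist_ell1_def uniformity_ell1_def open_ell1_def)+

end

definition isometric_to_ell1 :: "'a::real_normed_vector set \<Rightarrow> bool" where
  "isometric_to_ell1 L \<longleftrightarrow>
     (\<exists>T :: ell1 \<Rightarrow> 'a. linear T \<and> (\<forall>x. norm (T x) = norm x) \<and> range T = L)"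

end

theory Submission
  imports Defs "HOL-Library.Ramsey" "HOL-Library.Diagonal_Subsequence"
begin

text \<open>
  It suffices to find pairs \<open>(x i, y i)\<close> and radii \<open>p i + q i = d(x i, y i)\<close> such that balls belonging to
  different pairs are disjoint: the differences \<open>h i\<close> of the two tent functions on the \<open>i\<close>-th pair of
  balls satisfy \<open>\<Sum>i. \<bar>h i u - h i v\<bar> \<le> d(u, v)\<close>, so they define a norm-one map onto \<open>\<ell>\<^sub>1\<close> that inverts the
  embedding of \<open>\<ell>\<^sub>1\<close> by the normalised atoms of the pairs.

  If distances in \<open>X\<close> are not bounded away from 0, such a packing always exists. Otherwise,
  by exchanging mass in a finitely supported approximation, every nonzero element of \<open>TC(X)\<close>
  has an atom on which all its norming functionals are extremal. Applied to the images of the unit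
  vectors of \<open>\<ell>\<^sub>1\<close>, this gives pairs on which every choice of signs is realised by a 1-Lipschitz function.
  Every sequence of distinct points of \<open>X\<close> either yields a packing or has a subsequence which looks like
  a star seen from infinity; when both \<open>x\<close> and \<open>y\<close> are such stars, a Lipschitz function with alternating
  signs provides the radii.
\<close>

section \<open>Subsequences\<close>

lemma strict_mono_choice:
  assumes "\<And>n::nat. infinite {k::nat. P n k}"
  shows "\<exists>s :: nat \<Rightarrow> nat. strict_mono s \<and> (\<forall>n. P n (s n))"
proof -
  have ex: "\<exists>k>m. P n k" for n m :: nat
  proof (rule ccontr)
    assume "\<not> ?thesis"
    hence "{k. P n k} \<subseteq> {..m}" by (auto simp: not_less)
    thus False using assms[of n] finite_subset by blast
  qed
  have "\<exists>s. \<forall>n. P n (s n) \<and> s n < s (Suc n)"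
    by (rule dependent_nat_choice) (use ex in blast)+
  thus ?thesis by (auto simp: strict_mono_Suc_iff)
qed

lemma infinite_if_eventually_sequentially:
  assumes "eventually P sequentially"
  shows "infinite {k. P k}"
proof -
  obtain N where "\<And>k. k \<ge> N \<Longrightarrow> P k" using assms by (auto simp: eventually_sequentially)
  hence "{N..} \<subseteq> {k. P k}" by auto
  thus ?thesis using infinite_Ici finite_subset by blast
qed

lemma ramsey_subseq:
  fixes R :: "nat \<Rightarrow> nat \<Rightarrow> bool"
  shows "\<exists>s :: nat \<Rightarrow> nat. strict_mono s \<and>
    ((\<forall>i j. i < j \<longrightarrow> R (s i) (s j)) \<or> (\<forall>i j. i < j \<longrightarrow> \<not> R (s i) (s j)))"
proof -
  \<comment> \<open>Ramsey colours unordered pairs; reading a two-element set from its minimum to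
    its maximum recovers the ordered relation.\<close>
  define f where "f A = (if R (Min A) (Max A) then 1 else 0 :: nat)" for A
  have "\<forall>x\<in>UNIV. \<forall>y\<in>UNIV. x \<noteq> y \<longrightarrow> f {x, y} < 2" by (simp add: f_def)
  from Ramsey2[OF infinite_UNIV_nat this] obtain Y t where Y: "infinite Y"
    and t: "\<forall>x\<in>Y. \<forall>y\<in>Y. x \<noteq> y \<longrightarrow> f {x, y} = t"
    by (elim exE conjE)
  define s where "s = enumerate Y"
  have s: "strict_mono s" unfolding s_def by (rule strict_mono_enumerate[OF Y])
  have "R (s i) (s j) \<longleftrightarrow> t = 1" if "i < j" for i j
  proof -
    have lt: "s i < s j" using s that by (simp add: strict_mono_less)
    have "f {s i, s j} = t"
      using t lt enumerate_in_set[OF Y] by (auto simp: s_def)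
    thus ?thesis using lt by (auto simp: f_def split: if_splits)
  qed
  hence "(\<forall>i j. i < j \<longrightarrow> R (s i) (s j)) \<or> (\<forall>i j. i < j \<longrightarrow> \<not> R (s i) (s j))"
    by (cases "t = 1") auto
  with s show ?thesis by (intro exI[of _ s] conjI)
qed

text \<open>Each new index passes the threshold of its predecessor, and by monotonicity all later
  indices stay past it.\<close>

lemma sparse_subseq:
  assumes "\<And>i. \<forall>\<^sub>F j in sequentially. R i j"
  shows "\<exists>s :: nat \<Rightarrow> nat. strict_mono s \<and> (\<forall>i j. i < j \<longrightarrow> R (s i) (s j))"
proof -
  obtain N where N: "\<And>i j. N i \<le> j \<Longrightarrow> R i j"
    using assms unfolding eventually_sequentially by metis
  define s where "s = rec_nat 0 (\<lambda>_ m. Suc (max m (N m)))"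
  have s: "s (Suc n) = Suc (max (s n) (N (s n)))" for n by (simp add: s_def)
  have mono: "strict_mono s" by (simp add: strict_mono_Suc_iff s less_Suc_eq_le)
  have "R (s i) (s j)" if "i < j" for i j
  proof (rule N)
    have "N (s i) \<le> s (Suc i)" by (simp add: s)
    also have "\<dots> \<le> s j" using mono that by (simp add: strict_mono_less_eq)
    finally show "N (s i) \<le> s j" .
  qed
  with mono show ?thesis by (intro exI[of _ s]) auto
qed

lemma convergent_subseq_bounded:
  fixes w :: "nat \<Rightarrow> real"
  assumes "infinite {k. \<bar>w k\<bar> \<le> M}"
  shows "\<exists>(s :: nat \<Rightarrow> nat) L. strict_mono s \<and> (w \<circ> s) \<longlonglongrightarrow> L"
proof -
  obtain s :: "nat \<Rightarrow> nat" where s: "strict_mono s" "\<And>n. \<bar>w (s n)\<bar> \<le> M"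
    using strict_mono_choice[of "\<lambda>_ k. \<bar>w k\<bar> \<le> M"] assms by auto
  have "bounded (range (w \<circ> s))" using s(2) by (intro boundedI[of _ M]) auto
  then obtain L and r :: "nat \<Rightarrow> nat" where "strict_mono r" "((w \<circ> s) \<circ> r) \<longlonglongrightarrow> L"
    using bounded_imp_convergent_subsequence by blast
  thus ?thesis using strict_mono_o[OF s(1)] by (auto simp: o_assoc intro!: exI[of _ "s \<circ> r"])
qed

text \<open>If some bounded interval is visited infinitely often, Bolzano-Weierstrass applies.
  Otherwise every bounded interval is eventually left, and the lower bound \<open>c\<close> allows
  escape only upwards.\<close>

lemma convergent_or_at_top_subseq:
  fixes w :: "nat \<Rightarrow> real"
  assumes "\<forall>\<^sub>F k in sequentially. c \<le> w k"
  shows "\<exists>s :: nat \<Rightarrow> nat. strict_mono s \<and> ((\<exists>L. (w \<circ> s) \<longlonglongrightarrow> L) \<or> filterlim (w \<circ> s) at_top sequentially)"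
proof (cases "\<exists>M. infinite {k. \<bar>w k\<bar> \<le> M}")
  case True
  thus ?thesis using convergent_subseq_bounded by blast
next
  case False
  have "filterlim w at_top sequentially"
    unfolding filterlim_at_top
  proof
    fix Z
    have "\<forall>\<^sub>F k in sequentially. \<not> \<bar>w k\<bar> \<le> max \<bar>Z\<bar> \<bar>c\<bar>"
      using False by (simp add: cofinite_eq_sequentially[symmetric] eventually_cofinite)
    with assms show "\<forall>\<^sub>F k in sequentially. Z \<le> w k"
      by eventually_elim linarith
  qed
  thus ?thesis by (intro exI[of _ id]) (auto simp: strict_mono_def)
qed

lemma subseq_const_or_inj:
  fixes f :: "nat \<Rightarrow> 'a"
  shows "\<exists>s :: nat \<Rightarrow> nat. strict_mono s \<and> (inj (f \<circ> s) \<or> (\<exists>a. \<forall>n. f (s n) = a))"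
proof -
  obtain s :: "nat \<Rightarrow> nat" where s: "strict_mono s"
    and "(\<forall>i j. i < j \<longrightarrow> f (s i) = f (s j)) \<or> (\<forall>i j. i < j \<longrightarrow> f (s i) \<noteq> f (s j))"
    using ramsey_subseq[of "\<lambda>i j. f i = f j"] by blast
  thus ?thesis
  proof (elim disjE)
    assume eq: "\<forall>i j. i < j \<longrightarrow> f (s i) = f (s j)"
    have "f (s n) = f (s 0)" for n
      using eq by (cases "n = 0") force+
    with s show ?thesis by blast
  next
    assume ne: "\<forall>i j. i < j \<longrightarrow> f (s i) \<noteq> f (s j)"
    have "inj (f \<circ> s)"
      by (rule linorder_inj_onI) (use ne in auto)
    with s show ?thesis by blast
  qed
qed

section \<open>Packings of pairs of balls\<close>

text \<open>For nonnegative radii this is disjointness of the open balls of pair \<open>i\<close>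
  from those of pair \<open>j\<close>. Radii of either sign are allowed, so that they can be given
  by formulas first and clamped afterwards.\<close>

definition fits ::
  "(nat \<Rightarrow> 'a::metric_space) \<Rightarrow> (nat \<Rightarrow> 'a) \<Rightarrow> (nat \<Rightarrow> real) \<Rightarrow> (nat \<Rightarrow> real) \<Rightarrow> nat \<Rightarrow> nat \<Rightarrow> bool"
  where "fits x y p q i j \<longleftrightarrow>
    p i + p j \<le> dist (x i) (x j) \<and> p i + q j \<le> dist (x i) (y j) \<and>
    q i + p j \<le> dist (y i) (x j) \<and> q i + q j \<le> dist (y i) (y j)"

text \<open>The two balls of one pair touch, so that the difference of their tents drops by the full
  distance from \<open>x i\<close> to \<open>y i\<close> and the resulting functional norms the
  atom.\<close>

definition ball_packing ::
  "(nat \<Rightarrow> 'a::metric_space) \<Rightarrow> (nat \<Rightarrow> 'a) \<Rightarrow> (nat \<Rightarrow> real) \<Rightarrow> (nat \<Rightarrow> real) \<Rightarrow> bool"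
  where "ball_packing x y p q \<longleftrightarrow>
    (\<forall>i. x i \<noteq> y i \<and> p i + q i = dist (x i) (y i) \<and> 0 \<le> p i \<and> 0 \<le> q i) \<and>
    (\<forall>i j. i \<noteq> j \<longrightarrow> fits x y p q i j)"

lemma fits_sym: "fits x y p q i j \<Longrightarrow> fits x y p q j i"
  unfolding fits_def
  using dist_commute[of "x i" "x j"] dist_commute[of "x i" "y j"]
    dist_commute[of "y i" "x j"] dist_commute[of "y i" "y j"] by linarith

lemma fits_comp: "fits (x \<circ> s) (y \<circ> s) (p \<circ> s) (q \<circ> s) i j \<longleftrightarrow> fits x y p q (s i) (s j)"
  by (simp add: fits_def)

text \<open>Here \<open>b\<close> and \<open>e\<close> are the radii of the partner balls. A
  negative \<open>a\<close> means \<open>b > r\<close>, so \<open>b + c \<le> D' \<le> D + r\<close>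
  already yields \<open>c \<le> D\<close>; a negative \<open>c\<close> is symmetric. If both are
  nonnegative, clamping only lowers them.\<close>

lemma clamp_add_le:
  fixes a b c e :: real
  assumes "a + b = r" "c + e = s" "a + c \<le> D" "b + c \<le> D'" "a + e \<le> D''"
    "D' \<le> D + r" "D'' \<le> D + s" "0 \<le> D" "0 \<le> r" "0 \<le> s"
  shows "max 0 (min a r) + max 0 (min c s) \<le> D"
proof -
  have a: "max 0 (min a r) \<le> max 0 a" and c: "max 0 (min c s) \<le> max 0 c"
    by (auto simp: max_def min_def)
  consider "a < 0" | "c < 0" | "0 \<le> a" "0 \<le> c" by linarith
  thus ?thesis
  proof cases
    case 1
    hence "max 0 (min a r) = 0" by (simp add: max_def min_def)
    moreover have "max 0 c \<le> D" using 1 assms by (intro max.boundedI) linarith+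
    ultimately show ?thesis using c by linarith
  next
    case 2
    hence "max 0 (min c s) = 0" by (simp add: max_def min_def)
    moreover have "max 0 a \<le> D" using 2 assms by (intro max.boundedI) linarith+
    ultimately show ?thesis using a by linarith
  next
    case 3
    hence "max 0 a = a" "max 0 c = c" by auto
    thus ?thesis using a c assms(3) by linarith
  qed
qed

text \<open>Lowering one radius of a pair to 0 and raising the other to the full distance repairs a negative
radius: by the triangle inequality the ball with negative radius was the redundant constraint.\<close>

lemma fits_clamp:
  fixes x y :: "nat \<Rightarrow> 'a::metric_space"
  assumes r: "\<And>i. p i + q i = dist (x i) (y i)" and f: "fits x y p q i j"
  shows "fits x y (\<lambda>i. max 0 (min (p i) (dist (x i) (y i)))) (\<lambda>i. max 0 (min (q i) (dist (x i) (y i)))) i j"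
proof -
  have r': "q i + p i = dist (x i) (y i)" for i using r by (simp add: add.commute)
  have c: "dist (y i) (x i) = dist (x i) (y i)" for i by (rule dist_commute)
  note f' = f[unfolded fits_def]
  note n = zero_le_dist[of "x i" "x j"] zero_le_dist[of "x i" "y j"]
    zero_le_dist[of "y i" "x j"] zero_le_dist[of "y i" "y j"]
    zero_le_dist[of "x i" "y i"] zero_le_dist[of "x j" "y j"]
  note t = dist_triangle[of "y i" "x j" "x i"] dist_triangle[of "x i" "y j" "x j"]
    dist_triangle[of "y i" "y j" "x i"] dist_triangle[of "x i" "x j" "y j"]
    dist_triangle[of "x i" "x j" "y i"] dist_triangle[of "y i" "y j" "x j"]
    dist_triangle[of "x i" "y j" "y i"] dist_triangle[of "y i" "x j" "y j"]
  note h = f' n t[unfolded c]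
  show ?thesis unfolding fits_def
  proof (intro conjI)
    show "max 0 (min (p i) (dist (x i) (y i))) + max 0 (min (p j) (dist (x j) (y j))) \<le> dist (x i) (x j)"
      by (rule clamp_add_le[where D' = "dist (y i) (x j)" and D'' = "dist (x i) (y j)", OF r r]) (use h in linarith)+
    show "max 0 (min (p i) (dist (x i) (y i))) + max 0 (min (q j) (dist (x j) (y j))) \<le> dist (x i) (y j)"
      by (rule clamp_add_le[where D' = "dist (y i) (y j)" and D'' = "dist (x i) (x j)", OF r r']) (use h in linarith)+
    show "max 0 (min (q i) (dist (x i) (y i))) + max 0 (min (p j) (dist (x j) (y j))) \<le> dist (y i) (x j)"
      by (rule clamp_add_le[where D' = "dist (x i) (x j)" and D'' = "dist (y i) (y j)", OF r' r]) (use h in linarith)+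
    show "max 0 (min (q i) (dist (x i) (y i))) + max 0 (min (q j) (dist (x j) (y j))) \<le> dist (y i) (y j)"
      by (rule clamp_add_le[where D' = "dist (x i) (y j)" and D'' = "dist (y i) (x j)", OF r' r']) (use h in linarith)+
  qed
qed

text \<open>The common last step of all constructions below: a sparse subsequence turns eventual
  constraints into constraints for all pairs, and clamping makes the radii nonnegative.\<close>

lemma ball_packing_if_eventually_fits:
  fixes x y :: "nat \<Rightarrow> 'a::metric_space"
  assumes ne: "\<And>i. x i \<noteq> y i" and r: "\<And>i. p i + q i = dist (x i) (y i)"
    and ev: "\<And>i. \<forall>\<^sub>F j in sequentially. fits x y p q i j"
  shows "\<exists>(x :: nat \<Rightarrow> 'a) y p q. ball_packing x y p q"
proof -
  obtain s :: "nat \<Rightarrow> nat" where s: "strict_mono s" "\<And>i j. i < j \<Longrightarrow> fits x y p q (s i) (s j)"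
    using sparse_subseq[of "fits x y p q"] ev by blast
  define p' where "p' i = max 0 (min (p i) (dist (x i) (y i)))" for i
  define q' where "q' i = max 0 (min (q i) (dist (x i) (y i)))" for i
  have lt: "fits (x \<circ> s) (y \<circ> s) (p' \<circ> s) (q' \<circ> s) i j" if "i < j" for i j
    unfolding fits_comp p'_def q'_def by (rule fits_clamp[OF r s(2)[OF that]])
  have "fits (x \<circ> s) (y \<circ> s) (p' \<circ> s) (q' \<circ> s) i j" if "i \<noteq> j" for i j
    using that lt[of i j] fits_sym[OF lt[of j i]] by (cases "i < j") auto
  \<comment> \<open>With \<open>d\<close> the distance, \<open>q i = d - p i\<close>, so the two
    clampings to \<open>[0, d]\<close> mirror each other and the sum stays \<open>d\<close>.\<close>
  moreover have "p' i + q' i = dist (x i) (y i)" "0 \<le> p' i" "0 \<le> q' i" for i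
    using r[of i] zero_le_dist[of "x i" "y i"] unfolding p'_def q'_def by linarith+
  ultimately have "ball_packing (x \<circ> s) (y \<circ> s) (p' \<circ> s) (q' \<circ> s)"
    using ne by (simp add: ball_packing_def)
  thus ?thesis by blast
qed

section \<open>Near-stars\<close>

text \<open>Each difference is bounded by the distance of its point from \<open>a\<close>, so a
  diagonal subsequence makes all of them converge.\<close>

lemma horofunction_subseq:
  fixes z :: "nat \<Rightarrow> 'a::metric_space"
  shows "\<exists>(s :: nat \<Rightarrow> nat) b. strict_mono s \<and> (\<forall>i. (\<lambda>j. dist (z (s i)) (z (s j)) - dist a (z (s j))) \<longlonglongrightarrow> b i)"
proof -
  define P where "P n s \<longleftrightarrow> convergent (\<lambda>j. dist (z n) (z (s j)) - dist a (z (s j)))"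
    for n and s :: "nat \<Rightarrow> nat"
  have P_iff: "P n s \<longleftrightarrow> (\<exists>L. (\<lambda>j. dist (z n) (z (s j)) - dist a (z (s j))) \<longlonglongrightarrow> L)" for n s
    by (simp add: P_def convergent_def)
  interpret subseqs P
  proof
    fix n and s :: "nat \<Rightarrow> nat"
    define f where "f j = dist (z n) (z (s j)) - dist a (z (s j))" for j
    have "\<bar>f j\<bar> \<le> dist (z n) a" for j
      unfolding f_def using abs_dist_diff_le[of "z n" "z (s j)" a] by (simp add: dist_commute)
    hence "bounded (range f)" by (intro boundedI[of _ "dist (z n) a"]) auto
    then obtain L and r :: "nat \<Rightarrow> nat" where "strict_mono r" "(f \<circ> r) \<longlonglongrightarrow> L"
      using bounded_imp_convergent_subsequence by blast
    thus "\<exists>r. strict_mono r \<and> P n (s \<circ> r)"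
      unfolding P_def f_def convergent_def by (intro exI[of _ r]) (auto simp: o_def)
  qed
  have conv: "P n diagseq" for n
  proof -
    \<comment> \<open>From index \<open>Suc n\<close> on, the diagonal sequence refines the
      selection made for \<open>n\<close>; dropping finitely many terms keeps the limit.\<close>
    have "P n (diagseq \<circ> ((+) (Suc n)))"
    proof (rule diagseq_holds)
      fix r s :: "nat \<Rightarrow> nat" and n assume "strict_mono r" "P n s"
      thus "P n (s \<circ> r)"
        unfolding P_def convergent_def
        using LIMSEQ_subseq_LIMSEQ[of "\<lambda>j. dist (z n) (z (s j)) - dist a (z (s j))" _ r]
        by (auto simp: o_def)
    qed
    then obtain L where "(\<lambda>j. dist (z n) (z (diagseq (j + Suc n))) - dist a (z (diagseq (j + Suc n)))) \<longlonglongrightarrow> L"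
      unfolding P_iff o_def by (auto simp: add.commute)
    from LIMSEQ_offset[OF this] show ?thesis unfolding P_iff ..
  qed
  have "\<forall>i. \<exists>L. (\<lambda>j. dist (z (diagseq i)) (z (diagseq j)) - dist a (z (diagseq j))) \<longlonglongrightarrow> L"
    using conv P_iff by auto
  from choice[OF this] subseq_diagseq show ?thesis by (auto intro!: exI[of _ diagseq])
qed

lemma eventually_even_odd:
  assumes "eventually P sequentially"
  shows "\<forall>\<^sub>F j in sequentially. P (2 * j) \<and> P (2 * j + 1)"
proof -
  obtain N where "\<And>n. n \<ge> N \<Longrightarrow> P n" using assms by (auto simp: eventually_sequentially)
  thus ?thesis by (auto simp: eventually_sequentially intro!: exI[of _ N])
qed

lemma strict_mono_even: "strict_mono (\<lambda>n::nat. 2 * n)" and strict_mono_odd: "strict_mono (\<lambda>n::nat. 2 * n + 1)"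
  by (auto simp: strict_mono_def)

text \<open>The points \<open>z i\<close> behave like the leaves of a star with legs \<open>u i\<close> whose centre is a virtual point at
infinity; the exact inequality says that the balls \<open>B(z i, u i)\<close> are disjoint.\<close>

definition near_star :: "(nat \<Rightarrow> 'a::metric_space) \<Rightarrow> (nat \<Rightarrow> real) \<Rightarrow> bool" where
  "near_star z u \<longleftrightarrow> (\<forall>i. (\<lambda>j. dist (z i) (z j) - u j) \<longlonglongrightarrow> u i) \<and>
    (\<forall>i j. i < j \<longrightarrow> u i + u j \<le> dist (z i) (z j))"

lemma near_star_lim: "near_star z u \<Longrightarrow> (\<lambda>j. dist (z i) (z j) - u j) \<longlonglongrightarrow> u i"
  by (simp add: near_star_def)

lemma near_star_ge: "near_star z u \<Longrightarrow> i \<noteq> j \<Longrightarrow> u i + u j \<le> dist (z i) (z j)"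
  unfolding near_star_def using dist_commute[of "z i" "z j"] add.commute[of "u i" "u j"]
  by (metis linorder_neqE_nat)

lemma near_star_subseq:
  assumes "near_star z u" "strict_mono s"
  shows "near_star (z \<circ> s) (u \<circ> s)"
  using LIMSEQ_subseq_LIMSEQ[OF near_star_lim[OF assms(1)] assms(2)] near_star_ge[OF assms(1)]
    strict_mono_eq[OF assms(2)]
  unfolding near_star_def by (auto simp: o_def)

text \<open>Let \<open>b\<close> be a horofunction of the sequence and \<open>\<rho>\<close> the distance to the base point. If \<open>\<rho> - b\<close> is
unbounded, consecutive points of a sparse subsequence pack with first radius \<open>(\<rho> + b) / 2\<close>. Otherwise
\<open>\<rho> - b \<longlonglongrightarrow> c\<close> and \<open>u = b + c / 2\<close> is asymptotically exact; by Ramsey, either \<open>u\<close> is a packing, or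
\<open>d(z i, z j) < u i + u j\<close> throughout and splitting the excess between the two points leaves
room for all sufficiently distant later pairs.\<close>

lemma near_star_or_ball_packing:
  fixes z :: "nat \<Rightarrow> 'a::metric_space"
  assumes "inj z"
  shows "(\<exists>(x :: nat \<Rightarrow> 'a) y p q. ball_packing x y p q) \<or>
    (\<exists>(s :: nat \<Rightarrow> nat) u. strict_mono s \<and> near_star (z \<circ> s) u)"
proof -
  define a where "a = z 0"
  obtain s0 :: "nat \<Rightarrow> nat" and b0 where s0: "strict_mono s0"
    and b0: "\<And>i. (\<lambda>j. dist (z (s0 i)) (z (s0 j)) - dist a (z (s0 j))) \<longlonglongrightarrow> b0 i"
    using horofunction_subseq[of z a] by blast
  \<comment> \<open>By the triangle inequality \<open>g\<close> is nonnegative, hence along a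
    subsequence it converges or tends to infinity.\<close>
  define g where "g k = dist a (z (s0 k)) - b0 k" for k
  have "b0 k \<le> dist (z (s0 k)) a" for k
  proof (rule LIMSEQ_le_const2[OF b0], intro exI allI impI)
    fix j show "dist (z (s0 k)) (z (s0 j)) - dist a (z (s0 j)) \<le> dist (z (s0 k)) a"
      using dist_triangle[of "z (s0 k)" "z (s0 j)" a] by linarith
  qed
  hence "0 \<le> g k" for k by (simp add: g_def dist_commute)
  then obtain s1 :: "nat \<Rightarrow> nat" where s1: "strict_mono s1"
    and g: "(\<exists>c. (g \<circ> s1) \<longlonglongrightarrow> c) \<or> filterlim (g \<circ> s1) at_top sequentially"
    using convergent_or_at_top_subseq[of 0 g] by auto
  define Z where "Z = z \<circ> s0 \<circ> s1"
  define \<rho> where "\<rho> j = dist a (Z j)" for j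
  define b where "b = b0 \<circ> s1"
  have s01: "strict_mono (s0 \<circ> s1)" by (rule strict_mono_o[OF s0 s1])
  have inj: "inj Z" unfolding Z_def o_assoc[symmetric]
    by (rule inj_compose[OF assms strict_mono_imp_inj_on[OF s01]])
  have b: "(\<lambda>j. dist (Z i) (Z j) - \<rho> j) \<longlonglongrightarrow> b i" for i
    using LIMSEQ_subseq_LIMSEQ[OF b0 s1] by (simp add: Z_def \<rho>_def b_def o_def)
  have g': "(\<exists>c. (\<lambda>k. \<rho> k - b k) \<longlonglongrightarrow> c) \<or> filterlim (\<lambda>k. \<rho> k - b k) at_top sequentially"
    using g by (simp add: g_def \<rho>_def Z_def b_def o_def)
  show ?thesis using g'
  proof (elim disjE exE)
    assume top: "filterlim (\<lambda>k. \<rho> k - b k) at_top sequentially"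
    have "\<forall>\<^sub>F l in sequentially. \<bar>dist (Z k) (Z l) - \<rho> l - b k\<bar> < 1" for k
      using tendstoD[OF b[of k], of 1] by (simp add: dist_real_def)
    then obtain s :: "nat \<Rightarrow> nat" where s: "strict_mono s"
      and near: "\<And>k l. k < l \<Longrightarrow> \<bar>dist (Z (s k)) (Z (s l)) - \<rho> (s l) - b (s k)\<bar> < 1"
      using sparse_subseq[of "\<lambda>k l. \<bar>dist (Z k) (Z l) - \<rho> l - b k\<bar> < 1"] by auto
    define x where "x k = Z (s (2 * k))" for k
    define y where "y k = Z (s (2 * k + 1))" for k
    define p where "p k = (\<rho> (s (2 * k)) + b (s (2 * k))) / 2" for k
    define q where "q k = dist (x k) (y k) - p k" for k
    have "s (2 * k) \<noteq> s (2 * k + 1)" for k using strict_mono_eq[OF s] by simp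
    hence ne: "x k \<noteq> y k" for k using inj by (auto simp: x_def y_def inj_eq)
    have ev: "\<forall>\<^sub>F j in sequentially. fits x y p q i j" for i
    proof -
      \<comment> \<open>Distances from pair \<open>i\<close> to a later point exceed
        \<open>\<rho> + b - 1\<close>, while the radii of pair \<open>j\<close> are at most
        \<open>\<rho> - M\<close> and \<open>\<rho> - M + 1\<close>. The margin 2 in
        \<open>C + 2 \<le> M\<close> pays for these two errors.\<close>
      define C where "C = max (p i - b (s (2 * i))) (q i - b (s (2 * i + 1)))"
      have "\<forall>\<^sub>F k in sequentially. 2 * C + 4 \<le> \<rho> k - b k"
        using top by (simp add: filterlim_at_top)
      hence "\<forall>\<^sub>F k in sequentially. 2 * C + 4 \<le> \<rho> (s k) - b (s k)"
        using s by (rule eventually_subseq[rotated])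
      from eventually_even_odd[OF this] eventually_gt_at_top[of i] show ?thesis
      proof eventually_elim
        case (elim j)
        define M where "M = (\<rho> (s (2 * j)) - b (s (2 * j))) / 2"
        have M: "C + 2 \<le> M" using elim by (simp add: M_def)
        have pj: "p j = \<rho> (s (2 * j)) - M" by (simp add: p_def M_def field_simps)
        have qj: "q j \<le> \<rho> (s (2 * j + 1)) - M + 1"
          using near[of "2 * j" "2 * j + 1"] pj
          by (simp add: q_def x_def y_def p_def M_def field_simps)
        have C: "p i - b (s (2 * i)) \<le> C" "q i - b (s (2 * i + 1)) \<le> C" by (auto simp: C_def)
        have "2 * i < 2 * j" "2 * i < 2 * j + 1" "2 * i + 1 < 2 * j" "2 * i + 1 < 2 * j + 1"
          using elim by auto
        from this[THEN near] show ?case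
          unfolding fits_def x_def y_def using M pj qj C by linarith
      qed
    qed
    show ?thesis
      using ball_packing_if_eventually_fits[OF ne _ ev] by (auto simp: q_def)
  next
    fix c assume c: "(\<lambda>k. \<rho> k - b k) \<longlonglongrightarrow> c"
    \<comment> \<open>The offset is forced: \<open>\<rho> - u\<close> tends to \<open>c / 2\<close>,
      which added to \<open>b i\<close> has to return \<open>u i\<close>.\<close>
    define u where "u i = b i + c / 2" for i
    have u: "(\<lambda>j. dist (Z i) (Z j) - u j) \<longlonglongrightarrow> u i" for i
      using tendsto_add[OF b[of i] tendsto_diff[OF c tendsto_const[of "c / 2"]]]
      by (simp add: u_def algebra_simps)
    obtain s :: "nat \<Rightarrow> nat" where s: "strict_mono s"
      and R: "(\<forall>i j. i < j \<longrightarrow> u (s i) + u (s j) \<le> dist (Z (s i)) (Z (s j))) \<or>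
        (\<forall>i j. i < j \<longrightarrow> \<not> u (s i) + u (s j) \<le> dist (Z (s i)) (Z (s j)))"
      using ramsey_subseq[of "\<lambda>i j. u i + u j \<le> dist (Z i) (Z j)"] by blast
    have lim: "(\<lambda>j. dist (Z (s i)) (Z (s j)) - u (s j)) \<longlonglongrightarrow> u (s i)" for i
      using LIMSEQ_subseq_LIMSEQ[OF u s] by (simp add: o_def)
    from R show ?thesis
    proof
      assume "\<forall>i j. i < j \<longrightarrow> u (s i) + u (s j) \<le> dist (Z (s i)) (Z (s j))"
      hence "near_star (z \<circ> (s0 \<circ> s1 \<circ> s)) (u \<circ> s)"
        using lim by (simp add: near_star_def Z_def)
      thus ?thesis using strict_mono_o[OF s01 s] by blast
    next
      assume gt: "\<forall>i j. i < j \<longrightarrow> \<not> u (s i) + u (s j) \<le> dist (Z (s i)) (Z (s j))"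
      define x where "x k = Z (s (2 * k))" for k
      define y where "y k = Z (s (2 * k + 1))" for k
      define d where "d k = u (s (2 * k)) + u (s (2 * k + 1)) - dist (x k) (y k)" for k
      define p where "p k = u (s (2 * k)) - d k / 2" for k
      define q where "q k = u (s (2 * k + 1)) - d k / 2" for k
      have d: "d k > 0" for k using gt by (simp add: d_def x_def y_def not_le)
      have "s (2 * k) \<noteq> s (2 * k + 1)" for k using strict_mono_eq[OF s] by simp
      hence ne: "x k \<noteq> y k" for k using inj by (auto simp: x_def y_def inj_eq)
      have r: "p k + q k = dist (x k) (y k)" for k by (simp add: p_def q_def d_def field_simps)
      have "\<forall>\<^sub>F j in sequentially. fits x y p q i j" for i
      proof -
        \<comment> \<open>The fixed positive slack \<open>d i / 2\<close> absorbs the vanishing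
          error in the star limit; the slack \<open>d j / 2\<close> of the later pair only
          helps.\<close>
        have 1: "\<forall>\<^sub>F n in sequentially. u (s m) - d i / 2 < dist (Z (s m)) (Z (s n)) - u (s n)" for m
          by (rule order_tendstoD(1)[OF lim]) (use d[of i] in simp)
        from eventually_even_odd[OF 1[of "2 * i"]] eventually_even_odd[OF 1[of "2 * i + 1"]]
        show ?thesis
        proof eventually_elim
          case (elim j)
          thus ?case using d[of j] unfolding fits_def x_def y_def p_def q_def by linarith
        qed
      qed
      from ball_packing_if_eventually_fits[OF ne r this] show ?thesis by blast
    qed
  qed
qed

text \<open>Distinct points with ever closer neighbours are thinned out to a near-star. If its legs
  stay away from 0, each leaf packs with its neighbour. If not, detours through leaves with tiny
  legs show that the star is exact, and consecutive leaves pack.\<close>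

lemma ball_packing_if_not_uniformly_discrete:
  assumes close: "\<And>e. e > 0 \<Longrightarrow> \<exists>x y :: 'a::metric_space. x \<noteq> y \<and> dist x y < e"
  shows "\<exists>(x :: nat \<Rightarrow> 'a) y p q. ball_packing x y p q"
proof -
  define S where "S e = {x :: 'a. \<exists>y. x \<noteq> y \<and> dist x y < e}" for e
  \<comment> \<open>If \<open>S e\<close> were finite, its points would have a least mutual
    distance; but two points closer than this and than \<open>e\<close> both belong to
    \<open>S e\<close>.\<close>
  have inf: "infinite (S e)" if "e > 0" for e
  proof
    assume fin: "finite (S e)"
    define D where "D = (\<lambda>(x, y). dist x y) ` (S e \<times> S e - Id)"
    have D: "finite D" "\<forall>d\<in>D. d > 0" using fin by (auto simp: D_def)
    define m where "m = Min (insert e D)"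
    have m: "m > 0" "m \<le> e" using D that by (auto simp: m_def)
    then obtain x y :: 'a where xy: "x \<noteq> y" "dist x y < m" using close by blast
    have "x \<in> S e" "y \<in> S e" using xy m by (force simp: S_def dist_commute)+
    hence "dist x y \<in> D" using xy by (force simp: D_def)
    hence "m \<le> dist x y" unfolding m_def using D by (intro Min_le) auto
    thus False using xy by simp
  qed
  have "\<exists>f. \<forall>n. f n \<in> S (1 / real (Suc n)) - f ` {..<n}"
  proof (rule dependent_wellorder_choice)
    fix n :: nat and f :: "nat \<Rightarrow> 'a"
    have "infinite (S (1 / real (Suc n)) - f ` {..<n})" by (intro Diff_infinite_finite inf) auto
    thus "\<exists>r. r \<in> S (1 / real (Suc n)) - f ` {..<n}" using infinite_imp_nonempty by blast
  next
    fix r :: 'a and f g :: "nat \<Rightarrow> 'a" and n :: nat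
    assume "\<And>m. m < n \<Longrightarrow> f m = g m"
    hence "f ` {..<n} = g ` {..<n}" by (intro image_cong) auto
    thus "(r \<in> S (1 / real (Suc n)) - f ` {..<n}) = (r \<in> S (1 / real (Suc n)) - g ` {..<n})" by simp
  qed
  then obtain z where z: "\<And>n. z n \<in> S (1 / real (Suc n))" and new: "\<And>n. z n \<notin> z ` {..<n}" by blast
  have "z i \<noteq> z j" if "i < j" for i j
  proof -
    have "z i \<in> z ` {..<j}" using that by simp
    thus ?thesis using new[of j] by metis
  qed
  hence inj: "inj z" by (intro linorder_inj_onI) auto
  show ?thesis
  proof (rule ccontr)
    assume no: "\<not> ?thesis"
    then obtain s :: "nat \<Rightarrow> nat" and u where s: "strict_mono s" and ns: "near_star (z \<circ> s) u"
      using near_star_or_ball_packing[OF inj] by blast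
    define Z where "Z = z \<circ> s"
    note ns = ns[folded Z_def]
    have injZ: "Z i \<noteq> Z j" if "i \<noteq> j" for i j
      using that inj strict_mono_eq[OF s] by (auto simp: Z_def inj_eq)
    have "\<exists>y. Z n \<noteq> y \<and> dist (Z n) y < 1 / real (Suc n)" for n
    proof -
      obtain y where "Z n \<noteq> y" "dist (Z n) y < 1 / real (Suc (s n))"
        using z[of "s n"] by (auto simp: S_def Z_def)
      moreover have "1 / real (Suc (s n)) \<le> 1 / real (Suc n)"
        using seq_suble[OF s, of n] by (intro divide_left_mono) auto
      ultimately show ?thesis by (intro exI[of _ y]) auto
    qed
    then obtain y where y: "\<And>n. Z n \<noteq> y n" "\<And>n. dist (Z n) (y n) < 1 / real (Suc n)" by metis
    show False
    proof (cases "\<exists>\<eta>>0. \<forall>\<^sub>F n in sequentially. \<eta> \<le> u n")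
      case True
      then obtain \<eta> where \<eta>: "\<eta> > 0" "\<forall>\<^sub>F n in sequentially. \<eta> \<le> u n" by blast
      have "\<forall>\<^sub>F n in sequentially. 1 / real (Suc n) < \<eta> / 2"
        by (rule order_tendstoD(2)[OF LIMSEQ_inverse_real_of_nat[unfolded inverse_eq_divide]])
          (use \<eta> in simp)
      with \<eta>(2) have "\<forall>\<^sub>F n in sequentially. \<eta> \<le> u n \<and> dist (Z n) (y n) < \<eta> / 2"
        by eventually_elim (use y(2) order_less_trans in blast)
      then obtain N where N: "\<And>n. n \<ge> N \<Longrightarrow> \<eta> \<le> u n \<and> dist (Z n) (y n) < \<eta> / 2"
        by (auto simp: eventually_sequentially)
      define x' where "x' n = Z (n + N)" for n
      define y' where "y' n = y (n + N)" for n
      \<comment> \<open>The leaf takes the whole distance as radius and its neighbour takes 0.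
        Leaves are \<open>2 * \<eta>\<close> apart, which leaves room for radii below
        \<open>\<eta> / 2\<close>.\<close>
      define p where "p n = dist (x' n) (y' n)" for n
      have ev: "\<forall>\<^sub>F j in sequentially. fits x' y' p (\<lambda>_. 0) i j" for i
        using eventually_gt_at_top[of i]
      proof eventually_elim
        case (elim j)
        have "2 * \<eta> \<le> dist (x' i) (x' j)"
          using near_star_ge[OF ns, of "i + N" "j + N"] N[of "i + N"] N[of "j + N"] elim
          by (simp add: x'_def)
        moreover have "p i < \<eta> / 2" "p j < \<eta> / 2"
          using N[of "i + N"] N[of "j + N"] by (simp_all add: p_def x'_def y'_def)
        moreover have "dist (x' i) (x' j) \<le> dist (x' i) (y' j) + p j"
          "dist (x' i) (x' j) \<le> p i + dist (y' i) (x' j)"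
          by (simp_all add: p_def dist_triangle2 dist_triangle)
        ultimately show ?case unfolding fits_def using \<eta>(1) zero_le_dist[of "y' i" "y' j"] by linarith
      qed
      have "\<exists>(x :: nat \<Rightarrow> 'a) y p q. ball_packing x y p q"
        by (rule ball_packing_if_eventually_fits[OF _ _ ev]) (auto simp: x'_def y'_def p_def y)
      with no show False ..
    next
      case False
      have small: "\<exists>k\<ge>N. u k < e" if "e > 0" for e N
        using False that unfolding eventually_sequentially by (meson not_le)
      have eq: "dist (Z i) (Z j) = u i + u j" if "i \<noteq> j" for i j
      proof (rule antisym)
        show "dist (Z i) (Z j) \<le> u i + u j"
        proof (rule field_le_epsilon)
          fix e :: real assume "e > 0"
          have 1: "\<forall>\<^sub>F k in sequentially. dist (Z m) (Z k) - u k < u m + e / 4" for m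
            by (rule order_tendstoD(2)[OF near_star_lim[OF ns]]) (use \<open>e > 0\<close> in simp)
          obtain N where N: "\<And>k. k \<ge> N \<Longrightarrow> dist (Z i) (Z k) - u k < u i + e / 4 \<and>
              dist (Z j) (Z k) - u k < u j + e / 4"
            using eventually_conj[OF 1[of i] 1[of j]] by (auto simp: eventually_sequentially)
          obtain k where "k \<ge> N" "u k < e / 4" using small[of "e / 4" N] \<open>e > 0\<close> by auto
          thus "dist (Z i) (Z j) \<le> u i + u j + e"
            using N[of k] dist_triangle2[of "Z i" "Z j" "Z k"] by linarith
        qed
        show "u i + u j \<le> dist (Z i) (Z j)" by (rule near_star_ge[OF ns that])
      qed
      have "\<exists>(x :: nat \<Rightarrow> 'a) y p q. ball_packing x y p q"
      proof (rule ball_packing_if_eventually_fits[of "\<lambda>k. Z (2 * k)" "\<lambda>k. Z (2 * k + 1)"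
            "\<lambda>k. u (2 * k)" "\<lambda>k. u (2 * k + 1)"])
        fix i
        show "Z (2 * i) \<noteq> Z (2 * i + 1)" using injZ by simp
        show "u (2 * i) + u (2 * i + 1) = dist (Z (2 * i)) (Z (2 * i + 1))" by (simp add: eq)
        show "\<forall>\<^sub>F j in sequentially.
            fits (\<lambda>k. Z (2 * k)) (\<lambda>k. Z (2 * k + 1)) (\<lambda>k. u (2 * k)) (\<lambda>k. u (2 * k + 1)) i j"
          using eventually_gt_at_top[of i]
        proof eventually_elim
          case (elim j)
          hence "2 * i \<noteq> 2 * j" "2 * i \<noteq> 2 * j + 1" "2 * i + 1 \<noteq> 2 * j" "2 * i + 1 \<noteq> 2 * j + 1"
            by presburger+
          from this[THEN eq] show ?case unfolding fits_def by linarith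
        qed
      qed
      with no show False ..
    qed
  qed
qed

section \<open>Pairs with independent signs\<close>

text \<open>This says that the normalised atoms \<open>(1_{x n} - 1_{y n}) / d(x n, y n)\<close> span \<open>\<ell>\<^sub>1\<close> isometrically.\<close>

definition sign_free :: "(nat \<Rightarrow> 'a::metric_space) \<Rightarrow> (nat \<Rightarrow> 'a) \<Rightarrow> bool" where
  "sign_free x y \<longleftrightarrow> (\<forall>\<theta>. range \<theta> \<subseteq> {1, -1} \<longrightarrow>
    (\<exists>l. (\<forall>u v. l u - l v \<le> dist u v) \<and> (\<forall>n. l (x n) - l (y n) = \<theta> n * dist (x n) (y n))))"

lemma sign_freeE:
  assumes "sign_free x y" "range \<theta> \<subseteq> {1, -1}"
  obtains l where "\<And>u v. l u - l v \<le> dist u v" "\<And>n. l (x n) - l (y n) = \<theta> n * dist (x n) (y n)"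
  using assms unfolding sign_free_def by blast

lemma sign_free_subseq:
  assumes "sign_free x y" "strict_mono s"
  shows "sign_free (x \<circ> s) (y \<circ> s)"
  unfolding sign_free_def
proof (intro allI impI)
  fix \<theta> :: "nat \<Rightarrow> real" assume \<theta>: "range \<theta> \<subseteq> {1, -1}"
  have inv: "the_inv s (s n) = n" for n
    using strict_mono_imp_inj_on[OF assms(2)] by (rule the_inv_f_f)
  have "range (\<theta> \<circ> the_inv s) \<subseteq> {1, -1}" using \<theta> by auto
  then obtain l where "\<And>u v. l u - l v \<le> dist u v"
    "\<And>n. l (x n) - l (y n) = (\<theta> \<circ> the_inv s) n * dist (x n) (y n)"
    using sign_freeE[OF assms(1)] by blast
  thus "\<exists>l. (\<forall>u v. l u - l v \<le> dist u v) \<and>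
      (\<forall>n. l ((x \<circ> s) n) - l ((y \<circ> s) n) = \<theta> n * dist ((x \<circ> s) n) ((y \<circ> s) n))"
    by (intro exI[of _ l]) (simp add: inv)
qed

lemma sign_free_swap:
  assumes "sign_free x y"
  shows "sign_free y x"
  unfolding sign_free_def
proof (intro allI impI)
  fix \<theta> :: "nat \<Rightarrow> real" assume "range \<theta> \<subseteq> {1, -1}"
  hence "range (\<lambda>n. - \<theta> n) \<subseteq> {1, -1}" by auto
  then obtain l where l: "\<And>u v. l u - l v \<le> dist u v"
    "\<And>n. l (x n) - l (y n) = - \<theta> n * dist (x n) (y n)"
    using sign_freeE[OF assms] by blast
  have "l (y n) - l (x n) = \<theta> n * dist (y n) (x n)" for n
    using l(2)[of n] by (simp add: dist_commute)
  with l(1) show "\<exists>l. (\<forall>u v. l u - l v \<le> dist u v) \<and> (\<forall>n. l (y n) - l (x n) = \<theta> n * dist (y n) (x n))"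
    by blast
qed

text \<open>Give \<open>i\<close> and \<open>j\<close> opposite signs and regroup the two realised
  differences into one between the \<open>x\<close>-points and one between the
  \<open>y\<close>-points.\<close>

lemma sign_free_swap_le:
  assumes "sign_free x y" "i \<noteq> j"
  shows "dist (x i) (y i) + dist (x j) (y j) \<le> dist (x i) (x j) + dist (y i) (y j)"
proof -
  have "range (\<lambda>n. if n = i then 1 else -1 :: real) \<subseteq> {1, -1}" by auto
  then obtain l where l: "\<And>u v. l u - l v \<le> dist u v"
    "\<And>n. l (x n) - l (y n) = (if n = i then 1 else -1) * dist (x n) (y n)"
    using sign_freeE[OF assms(1)] by blast
  from l(1)[of "x i" "x j"] l(1)[of "y j" "y i"] l(2)[of i] l(2)[of j] show ?thesis
    using assms(2) by (simp add: dist_commute)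
qed

text \<open>When all \<open>x n\<close> coincide, the swap inequality says that the balls around
  \<open>y n\<close> with the full distances as radii are disjoint.\<close>

lemma ball_packing_if_common_endpoint:
  fixes x y :: "nat \<Rightarrow> 'a::metric_space"
  assumes ne: "\<And>n. x n \<noteq> y n" and sf: "sign_free x y" and const: "\<And>n. x n = a"
  shows "\<exists>(x :: nat \<Rightarrow> 'a) y p q. ball_packing x y p q"
proof -
  have fit: "fits x y (\<lambda>_. 0) (\<lambda>n. dist (x n) (y n)) i j" if "i < j" for i j
    using sign_free_swap_le[OF sf, of i j] that const by (simp add: fits_def dist_commute)
  have ev: "\<forall>\<^sub>F j in sequentially. fits x y (\<lambda>_. 0) (\<lambda>n. dist (x n) (y n)) i j" for i
    using eventually_gt_at_top[of i] by eventually_elim (rule fit)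
  show ?thesis by (rule ball_packing_if_eventually_fits[OF ne _ ev]) simp
qed

text \<open>Taking half the defect \<open>w\<close> off each leg gives radii with the right sum. A
  large later defect makes room for the earlier pair, even in the mixed constraints, where passing
  from \<open>x i\<close> to \<open>y i\<close> costs the fixed amount \<open>r i\<close>.\<close>

lemma ball_packing_if_defect_at_top:
  fixes x y :: "nat \<Rightarrow> 'a::metric_space"
  assumes ne: "\<And>n. x n \<noteq> y n" and u: "near_star x u" and v: "near_star y v"
    and w: "filterlim (\<lambda>n. u n + v n - dist (x n) (y n)) at_top sequentially"
  shows "\<exists>(x :: nat \<Rightarrow> 'a) y p q. ball_packing x y p q"
proof -
  define r where "r n = dist (x n) (y n)" for n
  define w where "w n = u n + v n - r n" for n
  have ev: "\<forall>\<^sub>F j in sequentially. fits x y (\<lambda>n. u n - w n / 2) (\<lambda>n. v n - w n / 2) i j" for i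
  proof -
    define C where "C = max (- w i) (max (2 * (u i - v i + r i) - w i) (2 * (v i - u i + r i) - w i))"
    have "\<forall>\<^sub>F j in sequentially. C \<le> w j"
      using assms(4) by (simp add: filterlim_at_top w_def r_def)
    with eventually_gt_at_top[of i] show ?thesis
    proof eventually_elim
      case (elim j)
      have "- w i \<le> C" "2 * (u i - v i + r i) - w i \<le> C" "2 * (v i - u i + r i) - w i \<le> C"
        by (auto simp: C_def)
      moreover have "u i + u j \<le> dist (x i) (x j)" "v i + v j \<le> dist (y i) (y j)"
        using elim near_star_ge[OF u, of i j] near_star_ge[OF v, of i j] by auto
      moreover have "dist (x i) (x j) \<le> r i + dist (y i) (x j)" "dist (y i) (y j) \<le> r i + dist (x i) (y j)"
        unfolding r_def using dist_triangle[of "x i" "x j" "y i"] dist_triangle[of "y i" "y j" "x i"]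
        by (simp_all add: dist_commute)
      ultimately show ?case using elim unfolding fits_def by (simp add: field_simps)
    qed
  qed
  show ?thesis
    by (rule ball_packing_if_eventually_fits[OF ne _ ev]) (simp add: w_def r_def field_simps)
qed

text \<open>A Lipschitz function \<open>l\<close> with sign \<open>+\<close> at the even indices provides radii \<open>l (x i)\<close> and \<open>- l (y i)\<close> that
satisfy the constraints between \<open>x i\<close> and \<open>y j\<close> exactly. Sign \<open>-\<close> at the odd indices, sent to infinity,
bounds these radii by the legs \<open>u i\<close> and \<open>v i\<close> up to an additive constant, which a shift
of \<open>l\<close> removes.\<close>

lemma ball_packing_if_defect_convergent:
  fixes x y :: "nat \<Rightarrow> 'a::metric_space"
  assumes ne: "\<And>n. x n \<noteq> y n" and sf: "sign_free x y"
    and u: "near_star x u" and v: "near_star y v"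
    and w: "(\<lambda>n. u n + v n - dist (x n) (y n)) \<longlonglongrightarrow> L"
  shows "\<exists>(x :: nat \<Rightarrow> 'a) y p q. ball_packing x y p q"
proof -
  define w where "w n = u n + v n - dist (x n) (y n)" for n
  have w: "w \<longlonglongrightarrow> L" using w by (simp add: w_def[abs_def])
  \<comment> \<open>The swap inequality with \<open>j\<close> sent to infinity. A further limit over
    \<open>i\<close> then gives \<open>0 \<le> L\<close>.\<close>
  have w_ge: "- L \<le> w i" for i
  proof -
    have "(\<lambda>j. (dist (x i) (x j) - u j) + (dist (y i) (y j) - v j) + w j - u i - v i) \<longlonglongrightarrow> u i + v i + L - u i - v i"
      by (intro tendsto_intros near_star_lim[OF u] near_star_lim[OF v] w)
    moreover have "\<exists>N. \<forall>j\<ge>N. - w i \<le> (dist (x i) (x j) - u j) + (dist (y i) (y j) - v j) + w j - u i - v i"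
    proof (intro exI allI impI)
      fix j assume "Suc i \<le> j"
      thus "- w i \<le> (dist (x i) (x j) - u j) + (dist (y i) (y j) - v j) + w j - u i - v i"
        using sign_free_swap_le[OF sf, of i j] by (simp add: w_def)
    qed
    ultimately have "- w i \<le> u i + v i + L - u i - v i" by (rule LIMSEQ_le_const)
    thus ?thesis by simp
  qed
  have "- L \<le> L" using w by (rule LIMSEQ_le_const) (use w_ge in auto)
  hence L: "0 \<le> L" by simp
  define \<theta> :: "nat \<Rightarrow> real" where "\<theta> n = (if even n then 1 else -1)" for n
  have "range \<theta> \<subseteq> {1, -1}" by (auto simp: \<theta>_def)
  then obtain l where l: "\<And>z z'. l z - l z' \<le> dist z z'"
    and l\<theta>: "\<And>n. l (x n) - l (y n) = \<theta> n * dist (x n) (y n)"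
    using sign_freeE[OF sf] by blast
  define o' where "o' k = 2 * k + 1" for k :: nat
  have o': "strict_mono o'" unfolding o'_def by (rule strict_mono_odd)
  \<comment> \<open>An estimate for the value of \<open>l\<close> at the virtual centre of the star
    \<open>x\<close>. The Lipschitz bound controls it from below; sign -1 at an odd index moves from
    \<open>x\<close> to \<open>y\<close> and controls it from above, so it has a limit point
    \<open>\<kappa>\<close>.\<close>
  define \<mu> where "\<mu> k = l (x (o' k)) + u (o' k)" for k
  have dx: "(\<lambda>k. dist (x i) (x (o' k)) - u (o' k)) \<longlonglongrightarrow> u i" for i
    using LIMSEQ_subseq_LIMSEQ[OF near_star_lim[OF u] o'] by (simp add: o_def)
  have dy: "(\<lambda>k. dist (y i) (y (o' k)) - v (o' k)) \<longlonglongrightarrow> v i" for i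
    using LIMSEQ_subseq_LIMSEQ[OF near_star_lim[OF v] o'] by (simp add: o_def)
  have wo: "(\<lambda>k. w (o' k)) \<longlonglongrightarrow> L" using LIMSEQ_subseq_LIMSEQ[OF w o'] by (simp add: o_def)
  have \<mu>_lower: "l (x i) - (dist (x i) (x (o' k)) - u (o' k)) \<le> \<mu> k" for i k
    using l[of "x i" "x (o' k)"] by (simp add: \<mu>_def)
  have \<mu>_upper: "\<mu> k \<le> l (y i) + (dist (y i) (y (o' k)) - v (o' k)) + w (o' k)" for i k
    using l[of "y (o' k)" "y i"] l\<theta>[of "o' k"]
    by (simp add: \<mu>_def w_def \<theta>_def o'_def dist_commute)
  obtain \<sigma> :: "nat \<Rightarrow> nat" and \<kappa> where \<sigma>: "strict_mono \<sigma>" and \<kappa>: "(\<mu> \<circ> \<sigma>) \<longlonglongrightarrow> \<kappa>"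
  proof -
    have "\<forall>\<^sub>F k in sequentially. dist (x 0) (x (o' k)) - u (o' k) < u 0 + 1"
      by (rule order_tendstoD(2)[OF dx]) simp
    moreover have "\<forall>\<^sub>F k in sequentially. dist (y 0) (y (o' k)) - v (o' k) < v 0 + 1"
      by (rule order_tendstoD(2)[OF dy]) simp
    moreover have "\<forall>\<^sub>F k in sequentially. w (o' k) < L + 1"
      by (rule order_tendstoD(2)[OF wo]) simp
    ultimately have "\<forall>\<^sub>F k in sequentially. \<bar>\<mu> k\<bar> \<le> \<bar>l (x 0) - u 0 - 1\<bar> + \<bar>l (y 0) + v 0 + L + 2\<bar>"
    proof eventually_elim
      case (elim k)
      thus ?case using \<mu>_lower[of 0 k] \<mu>_upper[of k 0] by linarith
    qed
    hence "infinite {k. \<bar>\<mu> k\<bar> \<le> \<bar>l (x 0) - u 0 - 1\<bar> + \<bar>l (y 0) + v 0 + L + 2\<bar>}"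
      by (rule infinite_if_eventually_sequentially)
    from convergent_subseq_bounded[OF this] that show ?thesis by blast
  qed
  \<comment> \<open>\<open>a i\<close> and \<open>b i\<close> measure how far the radii
    \<open>l (x i) - \<kappa>\<close> and \<open>\<kappa> - l (y i)\<close> stay below the
    legs.\<close>
  define a where "a i = u i - l (x i) + \<kappa>" for i
  define b where "b i = v i + l (y i) - \<kappa>" for i
  have a_ge: "0 \<le> a i" for i
  proof -
    have "(\<lambda>k. \<mu> (\<sigma> k) + (dist (x i) (x (o' (\<sigma> k))) - u (o' (\<sigma> k)))) \<longlonglongrightarrow> \<kappa> + u i"
      using tendsto_add[OF \<kappa> LIMSEQ_subseq_LIMSEQ[OF dx \<sigma>]] by (simp add: o_def)
    hence "l (x i) \<le> \<kappa> + u i"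
      by (rule LIMSEQ_le_const) (use \<mu>_lower[of i] in \<open>auto simp: algebra_simps\<close>)
    thus ?thesis by (simp add: a_def)
  qed
  have b_ge: "- L \<le> b i" for i
  proof -
    have "(\<lambda>k. \<mu> (\<sigma> k) - w (o' (\<sigma> k)) - (dist (y i) (y (o' (\<sigma> k))) - v (o' (\<sigma> k)))) \<longlonglongrightarrow> \<kappa> - L - v i"
      using tendsto_diff[OF tendsto_diff[OF \<kappa> LIMSEQ_subseq_LIMSEQ[OF wo \<sigma>]] LIMSEQ_subseq_LIMSEQ[OF dy \<sigma>]]
      by (simp add: o_def)
    hence "\<kappa> - L - v i \<le> l (y i)"
      by (rule LIMSEQ_le_const2) (use \<mu>_upper[of _ i] in \<open>auto simp: algebra_simps\<close>)
    thus ?thesis by (simp add: b_def)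
  qed
  have ab: "a (2 * i) + b (2 * i) = w (2 * i)" for i
    using l\<theta>[of "2 * i"] by (simp add: a_def b_def w_def \<theta>_def)
  have we: "(\<lambda>i. w (2 * i)) \<longlonglongrightarrow> L" using LIMSEQ_subseq_LIMSEQ[OF w strict_mono_even] by (simp add: o_def)
  have "\<forall>\<^sub>F i in sequentially. w (2 * i) < L + 1"
    by (rule order_tendstoD(2)[OF we]) simp
  hence "\<forall>\<^sub>F i in sequentially. \<bar>a (2 * i)\<bar> \<le> 2 * L + 1"
  proof eventually_elim
    case (elim i)
    thus ?case using a_ge[of "2 * i"] b_ge[of "2 * i"] ab[of i] by linarith
  qed
  hence "infinite {i. \<bar>a (2 * i)\<bar> \<le> 2 * L + 1}"
    by (rule infinite_if_eventually_sequentially)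
  from convergent_subseq_bounded[OF this]
  obtain \<tau> :: "nat \<Rightarrow> nat" and A where \<tau>: "strict_mono \<tau>" and A: "(\<lambda>i. a (2 * \<tau> i)) \<longlonglongrightarrow> A"
    by (auto simp: o_def)
  have B: "(\<lambda>i. b (2 * \<tau> i)) \<longlonglongrightarrow> L - A"
  proof -
    have "(\<lambda>i. w (2 * \<tau> i) - a (2 * \<tau> i)) \<longlonglongrightarrow> L - A"
      using LIMSEQ_subseq_LIMSEQ[OF we \<tau>] A by (intro tendsto_diff) (auto simp: o_def)
    moreover have "w (2 * \<tau> i) - a (2 * \<tau> i) = b (2 * \<tau> i)" for i
      using ab[of "\<tau> i"] by simp
    ultimately show ?thesis by simp
  qed
  \<comment> \<open>This shift gives both slacks the limit \<open>L / 2\<close>. If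
    \<open>L > 0\<close> they are eventually positive; if \<open>L = 0\<close> then
    \<open>t = 0\<close> and the bounds on \<open>a\<close> and \<open>b\<close> suffice.\<close>
  define t where "t = L / 2 - A"
  have "\<forall>\<^sub>F i in sequentially. 0 \<le> a (2 * \<tau> i) + t \<and> 0 \<le> b (2 * \<tau> i) - t"
  proof (cases "L = 0")
    case True
    have "A \<ge> 0" using A by (rule LIMSEQ_le_const) (use a_ge in auto)
    moreover have "0 \<le> L - A" using B by (rule LIMSEQ_le_const) (use b_ge True in auto)
    ultimately have "t = 0" using True by (simp add: t_def)
    thus ?thesis using a_ge b_ge True by simp
  next
    case False
    have "\<forall>\<^sub>F i in sequentially. - t < a (2 * \<tau> i)" "\<forall>\<^sub>F i in sequentially. t < b (2 * \<tau> i)"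
      using L False by (auto intro!: order_tendstoD(1)[OF A] order_tendstoD(1)[OF B] simp: t_def)
    thus ?thesis by eventually_elim auto
  qed
  then obtain N where N: "\<And>i. i \<ge> N \<Longrightarrow> 0 \<le> a (2 * \<tau> i) + t \<and> 0 \<le> b (2 * \<tau> i) - t"
    by (auto simp: eventually_sequentially)
  define e where "e i = 2 * \<tau> (i + N)" for i
  have N': "0 \<le> a (e i) + t" "0 \<le> b (e i) - t" for i using N[of "i + N"] by (auto simp: e_def)
  have "e i \<noteq> e j" if "i < j" for i j
    using strict_mono_eq[OF \<tau>] that by (simp add: e_def)
  \<comment> \<open>Radii below the legs settle the constraints within each star; the Lipschitz
    bound for \<open>l\<close> settles the mixed ones.\<close>
  hence fit: "fits (x \<circ> e) (y \<circ> e) (\<lambda>i. l (x (e i)) - \<kappa> - t) (\<lambda>i. \<kappa> + t - l (y (e i))) i j" if "i < j" for i j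
    using near_star_ge[OF u, of "e i" "e j"] near_star_ge[OF v, of "e i" "e j"] that
      N'[of i] N'[of j] l[of "x (e i)" "y (e j)"] l[of "x (e j)" "y (e i)"]
    by (auto simp: fits_def a_def b_def dist_commute)
  have ev: "\<forall>\<^sub>F j in sequentially.
      fits (x \<circ> e) (y \<circ> e) (\<lambda>i. l (x (e i)) - \<kappa> - t) (\<lambda>i. \<kappa> + t - l (y (e i))) i j" for i
    using eventually_gt_at_top[of i] by eventually_elim (rule fit)
  show ?thesis
    by (rule ball_packing_if_eventually_fits[OF _ _ ev])
      (use ne l\<theta> in \<open>auto simp: e_def \<theta>_def\<close>)
qed

text \<open>Without a packing, neither side has a constant subsequence, so both become near-stars
  along a common subsequence. The swap inequality bounds the defect below, which leaves the two
  cases treated above.\<close>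

lemma ball_packing_if_sign_free:
  fixes x y :: "nat \<Rightarrow> 'a::metric_space"
  assumes ne: "\<And>n. x n \<noteq> y n" and sf: "sign_free x y"
  shows "\<exists>(x :: nat \<Rightarrow> 'a) y p q. ball_packing x y p q"
proof (rule ccontr)
  assume no: "\<not> ?thesis"
  have inj_subseq: "\<exists>s :: nat \<Rightarrow> nat. strict_mono s \<and> inj (x \<circ> s)"
    if "\<And>n. x n \<noteq> y n" "sign_free x y" for x y :: "nat \<Rightarrow> 'a"
  proof -
    obtain s :: "nat \<Rightarrow> nat" where s: "strict_mono s" "inj (x \<circ> s) \<or> (\<exists>a. \<forall>n. x (s n) = a)"
      using subseq_const_or_inj[of x] by blast
    moreover have False if "\<forall>n. x (s n) = a" for a
      using ball_packing_if_common_endpoint[OF _ sign_free_subseq[OF \<open>sign_free x y\<close> s(1)], of a]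
        that \<open>\<And>n. x n \<noteq> y n\<close> no by auto
    ultimately show ?thesis by blast
  qed
  obtain s1 :: "nat \<Rightarrow> nat" where s1: "strict_mono s1" "inj (x \<circ> s1)"
    using inj_subseq[OF ne sf] by blast
  obtain s2 :: "nat \<Rightarrow> nat" and u where s2: "strict_mono s2" "near_star (x \<circ> s1 \<circ> s2) u"
    using near_star_or_ball_packing[OF s1(2)] no by blast
  have s12: "strict_mono (s1 \<circ> s2)" by (rule strict_mono_o[OF s1(1) s2(1)])
  obtain s3 :: "nat \<Rightarrow> nat" where s3: "strict_mono s3" "inj (y \<circ> (s1 \<circ> s2) \<circ> s3)"
    using inj_subseq[OF _ sign_free_swap[OF sign_free_subseq[OF sf s12]]] ne by (metis comp_apply)
  obtain s4 :: "nat \<Rightarrow> nat" and v where s4: "strict_mono s4" "near_star (y \<circ> (s1 \<circ> s2) \<circ> s3 \<circ> s4) v"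
    using near_star_or_ball_packing[OF s3(2)] no by blast
  define s where "s = s1 \<circ> s2 \<circ> s3 \<circ> s4"
  have s: "strict_mono s" unfolding s_def by (intro strict_mono_o s1 s2 s3 s4)
  define X where "X = x \<circ> s"
  define Y where "Y = y \<circ> s"
  define U where "U = u \<circ> s3 \<circ> s4"
  have neXY: "X n \<noteq> Y n" for n using ne by (simp add: X_def Y_def)
  have sf': "sign_free X Y" unfolding X_def Y_def by (rule sign_free_subseq[OF sf s])
  have U: "near_star X U"
    using near_star_subseq[OF near_star_subseq[OF s2(2) s3(1)] s4(1)] by (simp add: X_def U_def s_def o_assoc)
  have V: "near_star Y v" using s4(2) by (simp add: Y_def s_def o_assoc)
  define w where "w n = U n + v n - dist (X n) (Y n)" for n
  have "\<forall>\<^sub>F k in sequentially. dist (X 0) (X k) - U k < U 0 + 1"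
    by (rule order_tendstoD(2)[OF near_star_lim[OF U]]) simp
  moreover have "\<forall>\<^sub>F k in sequentially. dist (Y 0) (Y k) - v k < v 0 + 1"
    by (rule order_tendstoD(2)[OF near_star_lim[OF V]]) simp
  ultimately have "\<forall>\<^sub>F k in sequentially. - w 0 - 2 \<le> w k"
    using eventually_gt_at_top[of 0]
  proof eventually_elim
    case (elim k)
    thus ?case using sign_free_swap_le[OF sf', of 0 k] by (simp add: w_def)
  qed
  then obtain s5 :: "nat \<Rightarrow> nat" where s5: "strict_mono s5"
    "(\<exists>L. (w \<circ> s5) \<longlonglongrightarrow> L) \<or> filterlim (w \<circ> s5) at_top sequentially"
    using convergent_or_at_top_subseq by blast
  have ne5: "(X \<circ> s5) n \<noteq> (Y \<circ> s5) n" for n using neXY by simp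
  note U5 = near_star_subseq[OF U s5(1)] and V5 = near_star_subseq[OF V s5(1)]
  from s5(2) show False
  proof (elim disjE exE)
    fix L assume "(w \<circ> s5) \<longlonglongrightarrow> L"
    thus False
      using ball_packing_if_defect_convergent[OF ne5 sign_free_subseq[OF sf' s5(1)] U5 V5, of L] no
      by (simp add: w_def[abs_def] o_def)
  next
    assume "filterlim (w \<circ> s5) at_top sequentially"
    thus False
      using ball_packing_if_defect_at_top[OF ne5 U5 V5] no
      by (simp add: w_def[abs_def] o_def)
  qed
qed

section \<open>Functionals on the transportation cost space\<close>

definition dual_ball :: "('a::real_normed_vector \<Rightarrow> real) set" where
  "dual_ball = {\<phi>. linear \<phi> \<and> (\<forall>z. \<phi> z \<le> norm z)}"

lemma dual_ball_linear: "\<phi> \<in> dual_ball \<Longrightarrow> linear \<phi>"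
  and dual_ball_le: "\<phi> \<in> dual_ball \<Longrightarrow> \<phi> z \<le> norm z"
  by (auto simp: dual_ball_def)

lemma dual_ball_abs_le: "\<phi> \<in> dual_ball \<Longrightarrow> \<bar>\<phi> z\<bar> \<le> norm z"
  using dual_ball_le[of \<phi> z] dual_ball_le[of \<phi> "- z"]
  by (simp add: linear_neg[OF dual_ball_linear])

lemma dual_ball_bounded_linear: "\<phi> \<in> dual_ball \<Longrightarrow> bounded_linear \<phi>"
  by (rule bounded_linear_intro[of _ 1])
    (use dual_ball_abs_le[of \<phi>] in \<open>simp_all add: linear_add[OF dual_ball_linear]
      linear_scale[OF dual_ball_linear]\<close>)

lemma dual_ball_uminus: "\<phi> \<in> dual_ball \<Longrightarrow> (\<lambda>z. - \<phi> z) \<in> dual_ball"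
  using dual_ball_abs_le[of \<phi>] by (auto simp: dual_ball_def abs_le_iff intro: linear_compose_neg)

lemma dual_ball_avg:
  assumes "\<phi> \<in> dual_ball" "\<psi> \<in> dual_ball"
  shows "(\<lambda>z. (\<phi> z + \<psi> z) / 2) \<in> dual_ball"
proof -
  have "linear (\<lambda>z. (1 / 2) *\<^sub>R (\<phi> z + \<psi> z))"
    by (intro linear_compose_scale_right linear_compose_add dual_ball_linear assms)
  moreover have "(\<phi> z + \<psi> z) / 2 \<le> norm z" for z
    using dual_ball_le[OF assms(1), of z] dual_ball_le[OF assms(2), of z] by simp
  ultimately show ?thesis by (simp add: dual_ball_def)
qed

text \<open>Zorn's lemma is applied to graphs, i.e. to subspaces of \<open>'a \<times> real\<close>; the bound \<open>r \<le> norm x\<close> alone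
forces such a subspace to be single-valued.\<close>

lemma hahn_banach_dual_ball:
  fixes \<phi> :: "'a::real_normed_vector \<Rightarrow> real"
  assumes V: "subspace V"
    and add: "\<And>x y. x \<in> V \<Longrightarrow> y \<in> V \<Longrightarrow> \<phi> (x + y) = \<phi> x + \<phi> y"
    and scale: "\<And>c x. x \<in> V \<Longrightarrow> \<phi> (c *\<^sub>R x) = c * \<phi> x"
    and le: "\<And>x. x \<in> V \<Longrightarrow> \<phi> x \<le> norm x"
  shows "\<exists>\<psi>\<in>dual_ball. \<forall>x\<in>V. \<psi> x = \<phi> x"
proof -
  define G where "G = (\<lambda>x. (x, \<phi> x)) ` V"
  define \<G> where "\<G> = {M. subspace M \<and> G \<subseteq> M \<and> (\<forall>x r. (x, r) \<in> M \<longrightarrow> r \<le> norm x)}"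
  have "subspace G"
    unfolding G_def
  proof (rule subspaceI)
    show "0 \<in> (\<lambda>x. (x, \<phi> x)) ` V"
      using subspace_0[OF V] scale[of 0 0] by (auto simp: zero_prod_def image_iff intro!: bexI[of _ 0])
  next
    fix z w assume "z \<in> (\<lambda>x. (x, \<phi> x)) ` V" "w \<in> (\<lambda>x. (x, \<phi> x)) ` V"
    thus "z + w \<in> (\<lambda>x. (x, \<phi> x)) ` V" by (auto simp: add subspace_add[OF V] image_iff)
  next
    fix c z assume "z \<in> (\<lambda>x. (x, \<phi> x)) ` V"
    thus "c *\<^sub>R z \<in> (\<lambda>x. (x, \<phi> x)) ` V" by (auto simp: scale subspace_scale[OF V] image_iff)
  qed
  hence "G \<in> \<G>" using le by (auto simp: \<G>_def G_def)
  hence ne: "\<G> \<noteq> {}" by blast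
  have "\<exists>M\<in>\<G>. \<forall>X\<in>\<G>. M \<subseteq> X \<longrightarrow> X = M"
  proof (rule subset_Zorn_nonempty[OF ne])
    fix C assume C: "C \<noteq> {}" "subset.chain \<G> C"
    have sub: "subspace X" if "X \<in> C" for X using C(2) that by (auto simp: \<G>_def subset_chain_def)
    have "subspace (\<Union>C)"
    proof (rule subspaceI)
      show "0 \<in> \<Union>C" using C(1) sub subspace_0 by blast
    next
      fix z w assume "z \<in> \<Union>C" "w \<in> \<Union>C"
      then obtain X Y where XY: "X \<in> C" "z \<in> X" "Y \<in> C" "w \<in> Y" by blast
      hence "X \<subseteq> Y \<or> Y \<subseteq> X" using C(2) by (auto simp: subset_chain_def)
      thus "z + w \<in> \<Union>C" using XY sub subspace_add by blast
    next
      fix c z assume "z \<in> \<Union>C"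
      thus "c *\<^sub>R z \<in> \<Union>C" using sub subspace_scale by blast
    qed
    thus "\<Union>C \<in> \<G>" using C by (auto simp: \<G>_def subset_chain_def)
  qed
  then obtain M where M: "M \<in> \<G>" and max: "\<And>X. X \<in> \<G> \<Longrightarrow> M \<subseteq> X \<Longrightarrow> X = M" by blast
  have sM: "subspace M" and GM: "G \<subseteq> M" and leM: "\<And>x r. (x, r) \<in> M \<Longrightarrow> r \<le> norm x"
    using M by (auto simp: \<G>_def)
  have uniq: "r = s" if "(x, r) \<in> M" "(x, s) \<in> M" for x r s
    using leM[of 0 "r - s"] leM[of 0 "s - r"] subspace_diff[OF sM that] subspace_diff[OF sM that(2,1)]
    by simp
  have dom: "\<exists>r. (x0, r) \<in> M" for x0
  proof -
    \<comment> \<open>A value at \<open>x0\<close> must lie above \<open>L\<close> and below every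
      \<open>norm (y + x0) - s\<close>; by \<open>sep\<close> the supremum of \<open>L\<close> does.
      Homogeneity reduces all multiples of \<open>x0\<close> to these two bounds.\<close>
    define L where "L = (\<lambda>(x, r). r - norm (x - x0)) ` M"
    have sep: "r - norm (x - x0) \<le> norm (y + x0) - s" if "(x, r) \<in> M" "(y, s) \<in> M" for x r y s
      using leM[of "x + y" "r + s"] subspace_add[OF sM that] norm_triangle_ineq[of "x - x0" "y + x0"]
      by simp
    have z: "(0, 0) \<in> M" using subspace_0[OF sM] by (simp add: zero_prod_def)
    have Lne: "L \<noteq> {}" using z by (auto simp: L_def)
    have Lbd: "bdd_above L" using sep[OF _ z] by (intro bdd_aboveI[of _ "norm (0 + x0) - 0"]) (auto simp: L_def)
    define a where "a = Sup L"
    have a1: "r - a \<le> norm (x - x0)" if "(x, r) \<in> M" for x r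
    proof -
      have "r - norm (x - x0) \<in> L" using that by (force simp: L_def)
      from cSup_upper[OF this Lbd] show ?thesis by (simp add: a_def)
    qed
    have a2: "s + a \<le> norm (y + x0)" if "(y, s) \<in> M" for y s
    proof -
      have "a \<le> norm (y + x0) - s" unfolding a_def
        by (rule cSup_least[OF Lne]) (use sep that in \<open>auto simp: L_def\<close>)
      thus ?thesis by simp
    qed
    have bound: "r + t * a \<le> norm (x + t *\<^sub>R x0)" if "(x, r) \<in> M" for x r t
    proof -
      have sc: "(x /\<^sub>R k, r / k) \<in> M" for k
        using subspace_scale[OF sM that, of "inverse k"] by (simp add: divide_inverse mult.commute)
      consider "t = 0" | "t > 0" | "t < 0" by linarith
      thus ?thesis
      proof cases
        case 1 thus ?thesis using leM[OF that] by simp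
      next
        case 2
        have "r + t * a = t * (r / t + a)" using 2 by (simp add: field_simps)
        also have "\<dots> \<le> t * norm (x /\<^sub>R t + x0)"
          using a2[OF sc[of t]] 2 by (intro mult_left_mono) auto
        also have "\<dots> = norm (t *\<^sub>R (x /\<^sub>R t + x0))" using 2 by simp
        also have "t *\<^sub>R (x /\<^sub>R t + x0) = x + t *\<^sub>R x0" using 2 by (simp add: scaleR_add_right)
        finally show ?thesis .
      next
        case 3
        have "r + t * a = (- t) * (r / (- t) - a)" using 3 by (simp add: field_simps)
        also have "\<dots> \<le> (- t) * norm (x /\<^sub>R (- t) - x0)"
          using a1[OF sc[of "- t"]] 3 by (intro mult_left_mono) auto
        also have "\<dots> = norm ((- t) *\<^sub>R (x /\<^sub>R (- t) - x0))" using 3 by simp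
        also have "(- t) *\<^sub>R (x /\<^sub>R (- t) - x0) = x + t *\<^sub>R x0" using 3 by (simp add: scaleR_diff_right)
        finally show ?thesis .
      qed
    qed
    define M' where "M' = {z + w |z w. z \<in> M \<and> w \<in> span {(x0, a)}}"
    have "subspace M'" unfolding M'_def by (intro subspace_sums sM subspace_span)
    moreover have MM': "M \<subseteq> M'"
    proof
      fix m assume "m \<in> M"
      hence "m = m + 0 \<and> m \<in> M \<and> 0 \<in> span {(x0, a)}" by (simp add: span_zero)
      thus "m \<in> M'" unfolding M'_def by blast
    qed
    moreover have "r \<le> norm x" if xr: "(x, r) \<in> M'" for x r
    proof -
      obtain y s t where "(y, s) \<in> M" "(x, r) = (y, s) + t *\<^sub>R (x0, a)"
        using xr by (auto simp: M'_def span_singleton)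
      thus ?thesis using bound[of y s t] by simp
    qed
    ultimately have "M' \<in> \<G>" using GM by (auto simp: \<G>_def)
    hence "M' = M" using max MM' by blast
    moreover have "(x0, a) \<in> M'"
    proof -
      have "(x0, a) = (0, 0) + (x0, a) \<and> (0, 0) \<in> M \<and> (x0, a) \<in> span {(x0, a)}"
        using z by (simp add: span_base)
      thus ?thesis unfolding M'_def by blast
    qed
    ultimately show ?thesis by blast
  qed
  define \<psi> where "\<psi> x = (THE r. (x, r) \<in> M)" for x
  have \<psi>: "(x, \<psi> x) \<in> M" for x
    unfolding \<psi>_def using dom uniq by (metis theI)
  have "linear \<psi>"
  proof
    fix x y :: 'a and c :: real
    show "\<psi> (x + y) = \<psi> x + \<psi> y"
      by (rule uniq[OF \<psi>]) (use subspace_add[OF sM \<psi> \<psi>] in simp)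
    show "\<psi> (c *\<^sub>R x) = c *\<^sub>R \<psi> x"
      by (rule uniq[OF \<psi>]) (use subspace_scale[OF sM \<psi>] in simp)
  qed
  moreover have "\<psi> x = \<phi> x" if "x \<in> V" for x
    by (rule uniq[OF \<psi>]) (use GM that in \<open>auto simp: G_def\<close>)
  ultimately show ?thesis using leM[OF \<psi>] by (auto simp: dual_ball_def)
qed

section \<open>Pairing transportation problems with functions\<close>

definition tp_pair :: "'a tp \<Rightarrow> ('a \<Rightarrow> real) \<Rightarrow> real" where
  "tp_pair g l = (\<Sum>v | tp_fun g v \<noteq> 0. tp_fun g v * l v)"

lemma tp_pair_superset:
  assumes "finite A" "{v. tp_fun g v \<noteq> 0} \<subseteq> A"
  shows "tp_pair g l = (\<Sum>v\<in>A. tp_fun g v * l v)"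
  unfolding tp_pair_def by (rule sum.mono_neutral_left) (use assms in auto)

lemma tp_pair_add_left: "tp_pair (g + h) l = tp_pair g l + tp_pair h l"
proof -
  define A where "A = {v. tp_fun g v \<noteq> 0} \<union> {v. tp_fun h v \<noteq> 0}"
  have A: "finite A" by (simp add: A_def finite_supp_tp)
  show ?thesis
    by (subst (1 2 3) tp_pair_superset[OF A])
      (auto simp: A_def plus_tp.rep_eq sum.distrib distrib_right)
qed

lemma tp_pair_scaleR_left: "tp_pair (c *\<^sub>R g) l = c * tp_pair g l"
  by (subst (1 2) tp_pair_superset[OF finite_supp_tp[of g]])
    (auto simp: scaleR_tp.rep_eq sum_distrib_left mult.assoc)

lemma tp_pair_const_right: "tp_pair g (\<lambda>_. c) = 0"
  using sum_tp_superset[OF finite_supp_tp order_refl, of g]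
  by (simp add: tp_pair_def flip: sum_distrib_right)

lemma tp_pair_add_right: "tp_pair g (\<lambda>v. l v + m v) = tp_pair g l + tp_pair g m"
  by (simp add: tp_pair_def distrib_left sum.distrib)

lemma tp_pair_diff_right: "tp_pair g (\<lambda>v. l v - m v) = tp_pair g l - tp_pair g m"
  by (simp add: tp_pair_def right_diff_distrib sum_subtractf)

lemma tp_pair_scale_right: "tp_pair g (\<lambda>v. c * l v) = c * tp_pair g l"
  by (simp add: tp_pair_def sum_distrib_left mult.left_commute)

lemma tp_pair_sum_right: "tp_pair g (\<lambda>v. \<Sum>i\<in>I. l i v) = (\<Sum>i\<in>I. tp_pair g (l i))"
  unfolding tp_pair_def sum_distrib_left by (rule sum.swap)

lemma tp_pair_abs_le:
  fixes g :: "'a::metric_space tp"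
  assumes "\<And>x y. l x - l y \<le> dist x y"
  shows "\<bar>tp_pair g l\<bar> \<le> norm g"
proof -
  have "\<bar>l x - l y\<bar> \<le> dist x y" for x y
    using assms[of x y] assms[of y x] by (simp add: dist_commute abs_le_iff)
  thus ?thesis
    unfolding norm_tp_def tp_pair_def
    by (intro tc_norm_ge plan_cost_dual) (auto simp: finite_supp_tp)
qed

lemma tp_pair_abs_le_lipschitz:
  fixes g :: "'a::metric_space tp"
  assumes "C > 0" "\<And>x y. l x - l y \<le> C * dist x y"
  shows "\<bar>tp_pair g l\<bar> \<le> C * norm g"
proof -
  have "\<bar>tp_pair g (\<lambda>v. (1 / C) * l v)\<bar> \<le> norm g"
    by (rule tp_pair_abs_le) (use assms in \<open>simp add: field_simps\<close>)
  hence "\<bar>tp_pair g l\<bar> / C \<le> norm g"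
    unfolding tp_pair_scale_right using assms(1) by (simp add: abs_mult)
  thus ?thesis using assms(1) by (simp add: pos_divide_le_eq mult.commute)
qed

lift_definition atom :: "'a \<Rightarrow> 'a \<Rightarrow> 'a tp" is "\<lambda>x y v. indicator {x} v - indicator {y} v"
  by (rule tp_memI[of "{x, y}" for x y])
    (auto simp: sum_subtractf indicator_def)

lemma tp_pair_atom: "tp_pair (atom x y) l = l x - l y"
proof (cases "x = y")
  case True
  thus ?thesis by (simp add: tp_pair_def atom.rep_eq)
next
  case False
  have "tp_pair (atom x y) l = (\<Sum>v\<in>{x, y}. tp_fun (atom x y) v * l v)"
    by (rule tp_pair_superset) (auto simp: atom.rep_eq indicator_def split: if_splits)
  thus ?thesis using False by (simp add: atom.rep_eq)
qed

lemma norm_atom_le: "norm (atom x y) \<le> dist x y"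
proof -
  have "transport_plan [(1, x, y)] (atom x y)"
    by (auto simp: transport_plan_def plan_sum_def atom.rep_eq)
  from tc_norm_le[OF this] show ?thesis by (simp add: norm_tp_def plan_cost_def)
qed

lemma tp_fun_sum: "tp_fun (\<Sum>i\<in>I. f i) v = (\<Sum>i\<in>I. tp_fun (f i) v)"
  by (induction I rule: infinite_finite_induct) (auto simp: plus_tp.rep_eq zero_tp.rep_eq)

text \<open>The total mass of \<open>g\<close> is zero, so the contributions at the base point
  \<open>a\<close> cancel.\<close>

lemma tp_eq_sum_atoms: "g = (\<Sum>v | tp_fun g v \<noteq> 0. tp_fun g v *\<^sub>R atom v a)"
proof -
  have "tp_fun g w = (\<Sum>v | tp_fun g v \<noteq> 0. tp_fun g v * (indicator {v} w - indicator {a} w))" for w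
  proof -
    have "(\<Sum>v | tp_fun g v \<noteq> 0. tp_fun g v * (indicator {v} w - indicator {a} w)) =
      (\<Sum>v | tp_fun g v \<noteq> 0. if w = v then tp_fun g v else 0) -
      tp_pair g (\<lambda>_. indicator {a} w)"
      unfolding tp_pair_def sum_subtractf[symmetric]
      by (rule sum.cong) (auto simp: algebra_simps indicator_def)
    thus ?thesis by (auto simp: tp_pair_const_right sum.delta' finite_supp_tp)
  qed
  hence "tp_fun g w = tp_fun (\<Sum>v | tp_fun g v \<noteq> 0. tp_fun g v *\<^sub>R atom v a) w" for w
    unfolding tp_fun_sum scaleR_tp.rep_eq atom.rep_eq .
  hence "tp_fun g = tp_fun (\<Sum>v | tp_fun g v \<noteq> 0. tp_fun g v *\<^sub>R atom v a)" by (rule ext)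
  thus ?thesis by (rule tp_fun_inject[THEN iffD1])
qed

lemma completion_closed_induct:
  assumes "closed {z. P z}" "\<And>g. P (to_completion g)"
  shows "P z"
proof -
  have "closure (range to_completion) \<subseteq> {z. P z}"
    by (rule closure_minimal) (use assms in auto)
  thus ?thesis by (auto simp: dense_to_completion)
qed

text \<open>The easy half of Kantorovich duality bounds the pairing on the image of the
  transportation problems; Hahn-Banach extends it.\<close>

lemma dual_ball_of_lipschitz:
  fixes l :: "'a::metric_space \<Rightarrow> real"
  assumes "\<And>x y. l x - l y \<le> dist x y"
  shows "\<exists>\<psi>\<in>dual_ball. \<forall>g. \<psi> (to_completion g) = tp_pair g l"
proof -
  have inj: "inj (to_completion :: 'a tp \<Rightarrow> _)"
    unfolding linear_injective_0[OF linear_to_completion]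
    by (metis norm_to_completion norm_eq_zero)
  define \<phi> where "\<phi> z = tp_pair (inv to_completion z) l" for z
  have \<phi>: "\<phi> (to_completion g) = tp_pair g l" for g by (simp add: \<phi>_def inv_f_f[OF inj])
  have "\<exists>\<psi>\<in>dual_ball. \<forall>z\<in>range to_completion. \<psi> z = \<phi> z"
  proof (rule hahn_banach_dual_ball)
    show "subspace (range (to_completion :: 'a tp \<Rightarrow> _))"
      by (rule linear_subspace_image[OF linear_to_completion subspace_UNIV])
  next
    fix z w :: "'a tc" assume "z \<in> range to_completion" "w \<in> range to_completion"
    thus "\<phi> (z + w) = \<phi> z + \<phi> w"
      by (auto simp: \<phi> tp_pair_add_left simp flip: linear_add[OF linear_to_completion])
  next
    fix c and z :: "'a tc" assume "z \<in> range to_completion"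
    thus "\<phi> (c *\<^sub>R z) = c * \<phi> z"
      by (auto simp: \<phi> tp_pair_scaleR_left simp flip: linear_scale[OF linear_to_completion])
  next
    fix z :: "'a tc" assume "z \<in> range to_completion"
    thus "\<phi> z \<le> norm z"
      using tp_pair_abs_le[of l] assms by (auto simp: \<phi> norm_to_completion abs_le_iff)
  qed
  thus ?thesis using \<phi> by auto
qed

lemma dual_ball_atom_le: "\<phi> \<in> dual_ball \<Longrightarrow> \<phi> (to_completion (atom x y)) \<le> dist x y"
  using dual_ball_le[of \<phi> "to_completion (atom x y)"] norm_atom_le[of x y]
  by (simp add: norm_to_completion)

text \<open>Converse to \<open>dual_ball_of_lipschitz\<close>: atoms span the transportation
  problems, so a functional there is pairing with its values on atoms.\<close>

lemma dual_ball_eq_tp_pair: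
  assumes "\<phi> \<in> dual_ball"
  shows "\<phi> (to_completion g) = tp_pair g (\<lambda>v. \<phi> (to_completion (atom v a)))"
proof -
  have lin: "linear (\<lambda>g. \<phi> (to_completion g))"
    using linear_compose[OF linear_to_completion dual_ball_linear[OF assms]] by (simp add: o_def)
  show ?thesis
    by (subst tp_eq_sum_atoms[of g a])
      (simp add: linear_sum[OF lin] linear_scale[OF lin] tp_pair_def)
qed

lemma dual_ball_atom_diff:
  assumes "\<phi> \<in> dual_ball"
  shows "\<phi> (to_completion (atom x y)) = \<phi> (to_completion (atom x a)) - \<phi> (to_completion (atom y a))"
  by (subst dual_ball_eq_tp_pair[OF assms, of _ a]) (simp add: tp_pair_atom)

section \<open>From packings to complemented subspaces\<close>

text \<open>On transportation problems, suitable signs turn the sum into the pairing with a single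
  1-Lipschitz function; density does the rest.\<close>

lemma dual_ball_sum_abs_le:
  fixes h :: "'i \<Rightarrow> 'a::metric_space \<Rightarrow> real"
  assumes h: "\<And>u v. (\<Sum>i\<in>I. \<bar>h i u - h i v\<bar>) \<le> dist u v"
    and \<psi>: "\<And>i. i \<in> I \<Longrightarrow> \<psi> i \<in> dual_ball" "\<And>i g. i \<in> I \<Longrightarrow> \<psi> i (to_completion g) = tp_pair g (h i)"
  shows "(\<Sum>i\<in>I. \<bar>\<psi> i z\<bar>) \<le> norm z"
proof (rule completion_closed_induct[of "\<lambda>z. (\<Sum>i\<in>I. \<bar>\<psi> i z\<bar>) \<le> norm z"])
  have "continuous_on UNIV (\<psi> i)" if "i \<in> I" for i
    using dual_ball_bounded_linear[OF \<psi>(1)[OF that]] by (rule linear_continuous_on)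
  thus "closed {z. (\<Sum>i\<in>I. \<bar>\<psi> i z\<bar>) \<le> norm z}"
    by (intro closed_Collect_le continuous_on_sum continuous_on_rabs continuous_intros)
next
  fix g :: "'a tp"
  define \<sigma> where "\<sigma> i = (if tp_pair g (h i) \<ge> 0 then 1 else -1 :: real)" for i
  have "(\<Sum>i\<in>I. \<bar>\<psi> i (to_completion g)\<bar>) = (\<Sum>i\<in>I. \<sigma> i * tp_pair g (h i))"
    by (intro sum.cong) (auto simp: \<psi>(2) \<sigma>_def)
  also have "\<dots> = tp_pair g (\<lambda>v. \<Sum>i\<in>I. \<sigma> i * h i v)"
    by (simp add: tp_pair_sum_right tp_pair_scale_right)
  also have "\<dots> \<le> norm g"
  proof (rule order_trans[OF abs_ge_self tp_pair_abs_le])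
    fix u v
    have "(\<Sum>i\<in>I. \<sigma> i * h i u) - (\<Sum>i\<in>I. \<sigma> i * h i v) = (\<Sum>i\<in>I. \<sigma> i * (h i u - h i v))"
      by (simp add: sum_subtractf right_diff_distrib)
    also have "\<dots> \<le> (\<Sum>i\<in>I. \<bar>h i u - h i v\<bar>)" by (intro sum_mono) (auto simp: \<sigma>_def)
    finally show "(\<Sum>i\<in>I. \<sigma> i * h i u) - (\<Sum>i\<in>I. \<sigma> i * h i v) \<le> dist u v"
      using h[of u v] by linarith
  qed
  finally show "(\<Sum>i\<in>I. \<bar>\<psi> i (to_completion g)\<bar>) \<le> norm (to_completion g)"
    by (simp add: norm_to_completion)
qed

text \<open>At each point at most one tent is nonzero, so at most two terms survive. If different
  tents are active at \<open>u\<close> and at \<open>v\<close>, the gap between their balls bounds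
  the sum of heights; otherwise a single 1-Lipschitz term remains.\<close>

lemma sum_abs_tents_le:
  fixes c :: "'k \<Rightarrow> 'a::metric_space"
  assumes K: "finite K"
    and disj: "\<And>k m. k \<in> K \<Longrightarrow> m \<in> K \<Longrightarrow> k \<noteq> m \<Longrightarrow> \<rho> k + \<rho> m \<le> dist (c k) (c m)"
  shows "(\<Sum>k\<in>K. \<bar>max 0 (\<rho> k - dist (c k) u) - max 0 (\<rho> k - dist (c k) v)\<bar>) \<le> dist u v"
proof -
  define t where "t k w = max 0 (\<rho> k - dist (c k) w)" for k w
  have t0: "t k w \<ge> 0" for k w by (simp add: t_def)
  have lip: "\<bar>t k u - t k v\<bar> \<le> dist u v" for k
    using dist_triangle2[of "c k" u v] dist_triangle2[of "c k" v u] by (auto simp: t_def dist_commute)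
  have unique: "k = m" if "k \<in> K" "m \<in> K" "t k w > 0" "t m w > 0" for k m w
  proof (rule ccontr)
    assume "k \<noteq> m"
    with disj[OF that(1,2)] that(3,4) dist_triangle2[of "c k" "c m" w] show False
      by (auto simp: t_def)
  qed
  have two: "t k u + t m v \<le> dist u v" if "k \<in> K" "m \<in> K" "k \<noteq> m" "t k u > 0" "t m v > 0" for k m
    using disj[OF that(1-3)] that(4,5) dist_triangle2[of "c k" "c m" v] dist_triangle2[of "c k" v u]
    by (auto simp: t_def dist_commute)
  have pos: "t k w \<noteq> 0 \<Longrightarrow> 0 < t k w" for k w using t0[of k w] by simp
  have zero: "t j w = 0" if "j \<in> K" "k \<in> K" "t k w \<noteq> 0" "j \<noteq> k" for j k w
    using unique[of j k w] pos[of j w] pos[of k w] that by metis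
  have single: "(\<Sum>k\<in>K. \<bar>t k u - t k v\<bar>) \<le> dist u v"
    if "\<And>j. j \<in> K \<Longrightarrow> j \<noteq> m \<Longrightarrow> t j u = 0 \<and> t j v = 0" for m
  proof -
    have "(\<Sum>k\<in>K. \<bar>t k u - t k v\<bar>) \<le> (\<Sum>k\<in>K. if k = m then dist u v else 0)"
      by (rule sum_mono) (use that lip in auto)
    also have "\<dots> \<le> dist u v" using K by simp
    finally show ?thesis .
  qed
  have "(\<Sum>k\<in>K. \<bar>t k u - t k v\<bar>) \<le> dist u v"
  proof (cases "\<exists>k\<in>K. t k u \<noteq> 0")
    case True
    then obtain k where k: "k \<in> K" "t k u \<noteq> 0" by blast
    show ?thesis
    proof (cases "\<exists>m\<in>K. m \<noteq> k \<and> t m v \<noteq> 0")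
      case True
      then obtain m where m: "m \<in> K" "m \<noteq> k" "t m v \<noteq> 0" by blast
      have "(\<Sum>j\<in>K. \<bar>t j u - t j v\<bar>) \<le> (\<Sum>j\<in>K. (if j = k then t k u else 0) + (if j = m then t m v else 0))"
      proof (rule sum_mono)
        fix j assume "j \<in> K"
        thus "\<bar>t j u - t j v\<bar> \<le> (if j = k then t k u else 0) + (if j = m then t m v else 0)"
          using zero[of j k u] zero[of j m v] k m t0[of k u] t0[of m v] by (auto simp: abs_le_iff)
      qed
      also have "\<dots> = t k u + t m v" using K k m by (simp add: sum.distrib)
      also have "\<dots> \<le> dist u v" using k m by (intro two pos) auto
      finally show ?thesis .
    next
      case False
      show ?thesis by (rule single[of k]) (use False zero k in blast)
    qed
  next
    case False
    show ?thesis
    proof (cases "\<exists>m\<in>K. t m v \<noteq> 0")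
      case True
      then obtain m where "m \<in> K" "t m v \<noteq> 0" by blast
      thus ?thesis by (intro single[of m]) (use False zero in blast)
    qed (use False single in blast)
  qed
  thus ?thesis by (simp add: t_def)
qed

text \<open>The coordinate map \<open>Q\<close> into \<open>ell1\<close> and the synthesis map
  \<open>T\<close> are both contractions. Since \<open>Q\<close> inverts \<open>T\<close>, the
  latter is isometric and \<open>T \<circ> Q\<close> is the projection.\<close>

lemma complemented_ell1_if_biorthogonal:
  fixes m :: "nat \<Rightarrow> 'a::banach"
  assumes \<psi>: "\<And>i. bounded_linear (\<psi> i)" and sum: "\<And>N z. (\<Sum>i<N. \<bar>\<psi> i z\<bar>) \<le> norm z"
    and m: "\<And>i. norm (m i) \<le> 1" and dual: "\<And>i j. \<psi> j (m i) = (if i = j then 1 else 0)"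
  shows "\<exists>L :: 'a set. subspace L \<and> closed L \<and> isometric_to_ell1 L \<and>
    (\<exists>P :: 'a \<Rightarrow> 'a. bounded_linear P \<and> P \<circ> P = P \<and> range P = L \<and> onorm P = 1)"
proof -
  have sumQ: "summable (\<lambda>i. \<bar>\<psi> i z\<bar>)" for z
    by (rule summableI_nonneg_bounded[of _ "norm z"]) (use sum in auto)
  define Q where "Q z = Abs_ell1 (\<lambda>i. \<psi> i z)" for z
  have Q: "ell1_seq (Q z) = (\<lambda>i. \<psi> i z)" for z
    unfolding Q_def using sumQ by (simp add: Abs_ell1_inverse)
  have linQ: "linear Q"
  proof
    fix z w and c :: real
    show "Q (z + w) = Q z + Q w"
      by (rule ell1_seq_inject[THEN iffD1])
        (simp add: Q plus_ell1.rep_eq linear_add[OF bounded_linear.linear[OF \<psi>]])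
    show "Q (c *\<^sub>R z) = c *\<^sub>R Q z"
      by (rule ell1_seq_inject[THEN iffD1])
        (simp add: Q scaleR_ell1.rep_eq linear_scale[OF bounded_linear.linear[OF \<psi>]])
  qed
  have normQ: "norm (Q z) \<le> norm z" for z
    unfolding norm_ell1.rep_eq Q by (rule suminf_le_const[OF sumQ]) (rule sum)
  define T where "T x = (\<Sum>n. ell1_seq x n *\<^sub>R m n)" for x
  have nle: "norm (ell1_seq x n *\<^sub>R m n) \<le> \<bar>ell1_seq x n\<bar>" for x n
    using mult_left_mono[OF m, of "\<bar>ell1_seq x n\<bar>" n] by simp
  have sumTn: "summable (\<lambda>n. norm (ell1_seq x n *\<^sub>R m n))" for x
    by (rule summable_comparison_test'[OF summable_ell1[of x], of 0]) (use nle in simp)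
  note sumT = summable_norm_cancel[OF sumTn]
  have linT: "linear T"
  proof
    fix x y :: ell1 and c :: real
    show "T (x + y) = T x + T y"
      unfolding T_def suminf_add[OF sumT sumT] by (simp add: plus_ell1.rep_eq scaleR_add_left)
    show "T (c *\<^sub>R x) = c *\<^sub>R T x"
      unfolding T_def suminf_scaleR_right[OF sumT] by (simp add: scaleR_ell1.rep_eq)
  qed
  have normT: "norm (T x) \<le> norm x" for x
  proof -
    have "norm (T x) \<le> (\<Sum>n. norm (ell1_seq x n *\<^sub>R m n))" unfolding T_def by (rule summable_norm[OF sumTn])
    also have "\<dots> \<le> norm x" unfolding norm_ell1.rep_eq
      by (rule suminf_le[OF _ sumTn summable_ell1]) (rule nle)
    finally show ?thesis .
  qed
  have QT: "Q (T x) = x" for x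
  proof (rule ell1_seq_inject[THEN iffD1], rule ext)
    fix j
    have "ell1_seq (Q (T x)) j = (\<Sum>n. \<psi> j (ell1_seq x n *\<^sub>R m n))"
      unfolding Q T_def by (rule bounded_linear.suminf[OF \<psi> sumT])
    also have "\<dots> = (\<Sum>n. if n = j then ell1_seq x n else 0)"
      by (rule suminf_cong) (simp add: linear_scale[OF bounded_linear.linear[OF \<psi>]] dual)
    also have "\<dots> = ell1_seq x j" using sums_If_finite_set[of "{j}" "ell1_seq x"] by (simp add: sums_iff)
    finally show "ell1_seq (Q (T x)) j = ell1_seq x j" .
  qed
  have isoT: "norm (T x) = norm x" for x
    using normT[of x] normQ[of "T x"] by (simp add: QT)
  define P where "P = T \<circ> Q"
  have linP: "linear P" unfolding P_def by (rule linear_compose[OF linQ linT])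
  have normP: "norm (P z) \<le> 1 * norm z" for z using normQ[of z] by (simp add: P_def isoT)
  have blP: "bounded_linear P"
    by (rule bounded_linear_intro[of _ 1]) (use linear_add[OF linP] linear_scale[OF linP] normP in auto)
  have PP: "P \<circ> P = P" by (simp add: P_def fun_eq_iff QT)
  have rP: "range P = range T"
  proof
    show "range T \<subseteq> range P"
    proof
      fix z assume "z \<in> range T"
      then obtain x where "z = T x" by blast
      hence "z = P (T x)" by (simp add: P_def QT)
      thus "z \<in> range P" by blast
    qed
  qed (auto simp: P_def)
  \<comment> \<open>As the fixed-point set of a continuous map, the range is closed.\<close>
  have fix_iff: "range T = {z. P z = z}"
    unfolding rP[symmetric] using PP by (auto simp: fun_eq_iff image_iff intro: sym)
  have "closed {z. P z = z}"
    by (intro closed_Collect_eq linear_continuous_on[OF blP] continuous_on_id)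
  moreover have "onorm P = 1"
  proof (rule antisym)
    show "onorm P \<le> 1" by (rule onorm_bound) (use normP in auto)
    define e where "e = Abs_ell1 (\<lambda>n. if n = 0 then 1 else 0)"
    have "summable (\<lambda>n. \<bar>if n = (0::nat) then 1 else 0 :: real\<bar>)"
      by (rule summable_finite[of "{0}"]) auto
    hence "ell1_seq e 0 = 1" by (simp add: e_def Abs_ell1_inverse)
    hence "e \<noteq> 0" by (auto simp: zero_ell1.rep_eq)
    hence "0 < norm (T e)" by (simp add: isoT)
    moreover have "norm (P (T e)) = norm (T e)" by (simp add: P_def QT)
    ultimately show "1 \<le> onorm P"
      using onorm[OF blP, of "T e"] by (simp add: mult_le_cancel_right1)
  qed
  moreover have "subspace (range T)" by (rule linear_subspace_image[OF linT subspace_UNIV])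
  moreover have "isometric_to_ell1 (range T)" unfolding isometric_to_ell1_def using linT isoT by blast
  ultimately show ?thesis using blP PP rP fix_iff by (intro exI[of _ "range T"] conjI exI[of _ P]) auto
qed

lemma complemented_ell1_if_ball_packing:
  fixes x y :: "nat \<Rightarrow> 'a::metric_space"
  assumes bp: "ball_packing x y p q"
  shows "\<exists>L :: 'a tc set. subspace L \<and> closed L \<and> isometric_to_ell1 L \<and>
    (\<exists>P :: 'a tc \<Rightarrow> 'a tc. bounded_linear P \<and> P \<circ> P = P \<and> range P = L \<and> onorm P = 1)"
proof -
  have ne: "x i \<noteq> y i" and r: "p i + q i = dist (x i) (y i)" and p0: "0 \<le> p i" and q0: "0 \<le> q i" for i
    using bp by (auto simp: ball_packing_def)
  have fit: "i \<noteq> j \<Longrightarrow> fits x y p q i j" for i j using bp by (auto simp: ball_packing_def)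
  define h where "h i v = max 0 (p i - dist (x i) v) - max 0 (q i - dist (y i) v)" for i v
  have h_sum: "(\<Sum>i\<in>I. \<bar>h i u - h i v\<bar>) \<le> dist u v" if I: "finite I" for I u v
  proof -
    \<comment> \<open>The Boolean selects the ball at \<open>x\<close> or at \<open>y\<close>, so
      that all tents form one disjoint family.\<close>
    define c where "c k = (if snd k then x (fst k) else y (fst k))" for k :: "nat \<times> bool"
    define \<rho> where "\<rho> k = (if snd k then p (fst k) else q (fst k))" for k :: "nat \<times> bool"
    have disj: "\<rho> k + \<rho> m \<le> dist (c k) (c m)" if "k \<noteq> m" for k m
    proof (cases "fst k = fst m")
      case True
      thus ?thesis using that r[of "fst m"] by (auto simp: \<rho>_def c_def prod_eq_iff dist_commute)
    next
      case False
      thus ?thesis using fit[OF False] by (auto simp: \<rho>_def c_def fits_def)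
    qed
    have tri: "\<bar>a - b - (a' - b')\<bar> \<le> \<bar>b - b'\<bar> + \<bar>a - a'\<bar>" for a b a' b' :: real by linarith
    have "(\<Sum>i\<in>I. \<bar>h i u - h i v\<bar>) \<le> (\<Sum>i\<in>I. \<Sum>b\<in>UNIV.
        \<bar>max 0 (\<rho> (i, b) - dist (c (i, b)) u) - max 0 (\<rho> (i, b) - dist (c (i, b)) v)\<bar>)"
      by (rule sum_mono) (simp add: UNIV_bool h_def \<rho>_def c_def tri)
    also have "\<dots> = (\<Sum>k\<in>I \<times> UNIV. \<bar>max 0 (\<rho> k - dist (c k) u) - max 0 (\<rho> k - dist (c k) v)\<bar>)"
      by (simp add: sum.cartesian_product case_prod_beta)
    also have "\<dots> \<le> dist u v" by (rule sum_abs_tents_le) (use I disj in auto)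
    finally show ?thesis .
  qed
  have "h i u - h i v \<le> dist u v" for i u v using h_sum[of "{i}" u v] by simp
  hence "\<exists>\<psi>. \<psi> \<in> dual_ball \<and> (\<forall>g. \<psi> (to_completion g) = tp_pair g (h i))" for i
    using dual_ball_of_lipschitz[of "h i"] by blast
  then obtain \<psi> where \<psi>: "\<And>i. \<psi> i \<in> dual_ball" "\<And>i g. \<psi> i (to_completion g) = tp_pair g (h i)"
    by metis
  define m where "m i = (1 / dist (x i) (y i)) *\<^sub>R to_completion (atom (x i) (y i))" for i
  show ?thesis
  proof (rule complemented_ell1_if_biorthogonal[of \<psi> m])
    show "bounded_linear (\<psi> i)" for i by (rule dual_ball_bounded_linear[OF \<psi>(1)])
    show "(\<Sum>i<N. \<bar>\<psi> i z\<bar>) \<le> norm z" for N z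
      by (rule dual_ball_sum_abs_le[where h = h]) (use h_sum \<psi> in auto)
    show "norm (m i) \<le> 1" for i
      using norm_atom_le[of "x i" "y i"] ne[of i] by (simp add: m_def norm_to_completion divide_le_eq)
    show "\<psi> j (m i) = (if i = j then 1 else 0)" for i j
    proof -
      have "\<psi> j (m i) = (h j (x i) - h j (y i)) / dist (x i) (y i)"
        using linear_scale[OF dual_ball_linear[OF \<psi>(1)]] by (simp add: m_def \<psi>(2) tp_pair_atom)
      \<comment> \<open>Nonnegative radii keep each centre out of all other open balls, so only its
        own tent can be nonzero there.\<close>
      moreover have "h j (x i) - h j (y i) = (if i = j then dist (x i) (y i) else 0)"
      proof (cases "i = j")
        case True
        have "q i - dist (y i) (x i) \<le> 0" "p i - dist (x i) (y i) \<le> 0"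
          using r[of i] p0[of i] q0[of i] dist_commute[of "y i" "x i"] by linarith+
        thus ?thesis using True r[of i] p0[of i] q0[of i] by (simp add: h_def max_absorb1 max_absorb2)
      next
        case False
        have "p j - dist (x j) (x i) \<le> 0" "q j - dist (y j) (x i) \<le> 0"
          "p j - dist (x j) (y i) \<le> 0" "q j - dist (y j) (y i) \<le> 0"
          using fit[of j i] False p0[of i] q0[of i] unfolding fits_def by fastforce+
        thus ?thesis using False by (simp add: h_def max_absorb1)
      qed
      ultimately show ?thesis using ne[of i] by (cases "i = j") simp_all
    qed
  qed
qed

section \<open>Norming pairs in uniformly discrete spaces\<close>

text \<open>Averaging two norming functionals keeps them norming and retains half of every strict
  gap of either one.\<close>

lemma dual_ball_uniform_gap:
  fixes K :: "('a::metric_space \<times> 'a) set"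
  assumes K: "finite K" and \<phi>0: "\<phi>0 \<in> dual_ball" "\<phi>0 f = norm f"
    and gap: "\<And>x y. (x, y) \<in> K \<Longrightarrow>
      \<exists>\<phi>\<in>dual_ball. \<phi> f = norm f \<and> \<phi> (to_completion (atom x y)) \<noteq> dist x y"
  shows "\<exists>\<phi>\<in>dual_ball. \<phi> f = norm f \<and>
    (\<exists>c>0. \<forall>(x, y)\<in>K. \<phi> (to_completion (atom x y)) \<le> dist x y - c)"
  using K gap
proof (induction K)
  case empty
  thus ?case using \<phi>0 by (intro bexI[of _ \<phi>0]) (auto intro: zero_less_one)
next
  case (insert k K)
  obtain x y where k: "k = (x, y)" by (cases k)
  obtain \<phi> c where \<phi>: "\<phi> \<in> dual_ball" "\<phi> f = norm f" "c > 0"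
    "\<And>x y. (x, y) \<in> K \<Longrightarrow> \<phi> (to_completion (atom x y)) \<le> dist x y - c"
    using insert.IH insert.prems by (fastforce)
  obtain \<psi> where \<psi>: "\<psi> \<in> dual_ball" "\<psi> f = norm f" "\<psi> (to_completion (atom x y)) \<noteq> dist x y"
    using insert.prems[of x y] by (auto simp: k)
  define e where "e = dist x y - \<psi> (to_completion (atom x y))"
  have e: "e > 0" using \<psi>(3) dual_ball_atom_le[OF \<psi>(1), of x y] by (simp add: e_def)
  have avg: "(\<phi> (to_completion (atom x' y')) + \<psi> (to_completion (atom x' y'))) / 2
      \<le> dist x' y' - min (c / 2) (e / 2)" if "(x', y') \<in> insert k K" for x' y'
  proof (cases "(x', y') = k")
    case True
    hence "x' = x" "y' = y" by (auto simp: k)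
    thus ?thesis
      using dual_ball_atom_le[OF \<phi>(1), of x y] by (simp add: e_def field_simps min_def)
  next
    case False
    hence "(x', y') \<in> K" using that by simp
    thus ?thesis
      using dual_ball_atom_le[OF \<psi>(1), of x' y'] \<phi>(4)[of x' y'] by (simp add: field_simps min_def)
  qed
  have "\<forall>(x', y')\<in>insert k K. (\<phi> (to_completion (atom x' y')) + \<psi> (to_completion (atom x' y'))) / 2
      \<le> dist x' y' - min (c / 2) (e / 2)"
    using avg by (metis (no_types, lifting) case_prodI2)
  moreover have "min (c / 2) (e / 2) > 0" using \<phi>(3) e by simp
  ultimately show ?case
    using dual_ball_avg[OF \<phi>(1) \<psi>(1)] \<phi>(2) \<psi>(2)
    by (intro bexI[of _ "\<lambda>z. (\<phi> z + \<psi> z) / 2"] conjI exI[of _ "min (c / 2) (e / 2)"]) auto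
qed

text \<open>The error can be made arbitrarily small while the positive mass stays bounded below: a
  fixed bounded Lipschitz function still detects a quarter of the norm of \<open>f\<close>.\<close>

lemma tp_positive_mass_ge:
  fixes f :: "'a::metric_space tc"
  assumes f: "f \<noteq> 0" and \<phi>: "\<phi> \<in> dual_ball" "\<phi> f = norm f" and s: "s > 0"
  shows "\<exists>g. norm (f - to_completion g) < s * (\<Sum>v | tp_fun g v > 0. tp_fun g v)"
proof -
  define n where "n = norm f"
  have n: "n > 0" using f by (simp add: n_def)
  obtain g0 where g0: "norm (f - to_completion g0) < n / 4"
    using to_completion_approx[of "n / 4" f] n by auto
  define l0 where "l0 v = \<phi> (to_completion (atom v undefined))" for v
  have l0: "l0 x - l0 y \<le> dist x y" for x y
    unfolding l0_def using dual_ball_atom_le[OF \<phi>(1), of x y] dual_ball_atom_diff[OF \<phi>(1), of x y undefined] by simp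
  define B where "B = (\<Sum>v | tp_fun g0 v \<noteq> 0. \<bar>l0 v\<bar>) + 1"
  have B: "B > 0" by (simp add: B_def add_nonneg_pos sum_nonneg)
  have l0_le: "\<bar>l0 v\<bar> \<le> B" if "tp_fun g0 v \<noteq> 0" for v
  proof -
    have "\<bar>l0 v\<bar> \<le> (\<Sum>v | tp_fun g0 v \<noteq> 0. \<bar>l0 v\<bar>)"
      by (rule member_le_sum) (use that in \<open>auto simp: finite_supp_tp\<close>)
    thus ?thesis by (simp add: B_def)
  qed
  \<comment> \<open>The shift by \<open>B\<close> is invisible to mass zero, and the truncation does
    not touch the support of \<open>g0\<close>; so \<open>l\<close> pairs with \<open>g0\<close> as
    \<open>l0\<close> does, with values in \<open>[0, 2 * B]\<close>.\<close>
  define l where "l v = max 0 (min (2 * B) (l0 v + B))" for v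
  have l: "l x - l y \<le> dist x y" for x y
    using l0[of x y] zero_le_dist[of x y] unfolding l_def by linarith
  have l_bd: "0 \<le> l v" "l v \<le> 2 * B" for v using B by (auto simp: l_def)
  have "tp_pair g0 l = tp_pair g0 (\<lambda>v. l0 v + B)"
    unfolding tp_pair_def
  proof (rule sum.cong)
    fix v assume "v \<in> {v. tp_fun g0 v \<noteq> 0}"
    hence "l v = l0 v + B" using l0_le[of v] by (simp add: l_def abs_le_iff)
    thus "tp_fun g0 v * l v = tp_fun g0 v * (l0 v + B)" by simp
  qed simp
  hence g0l: "tp_pair g0 l = \<phi> (to_completion g0)"
    by (simp add: tp_pair_add_right tp_pair_const_right l0_def flip: dual_ball_eq_tp_pair[OF \<phi>(1)])
  obtain \<psi> where \<psi>: "\<psi> \<in> dual_ball" "\<And>g. \<psi> (to_completion g) = tp_pair g l"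
    using dual_ball_of_lipschitz[of l] l by blast
  have close: "\<bar>\<eta> z - \<eta> w\<bar> \<le> norm (z - w)" if "\<eta> \<in> dual_ball" for \<eta> and z w :: "'a tc"
    using dual_ball_abs_le[OF that, of "z - w"] by (simp add: linear_diff[OF dual_ball_linear[OF that]])
  define \<delta> where "\<delta> = min (n / 4) (s * (n / (8 * B)))"
  have "\<delta> > 0" using n s B by (simp add: \<delta>_def)
  then obtain g where g: "norm (f - to_completion g) < \<delta>" using to_completion_approx[of \<delta> f] by auto
  have "n / 4 < \<psi> (to_completion g)"
    using close[OF \<phi>(1), of f "to_completion g0"] close[OF \<psi>(1), of f "to_completion g0"]
      close[OF \<psi>(1), of f "to_completion g"] g0 g g0l \<psi>(2)[of g0] \<phi>(2)
    unfolding \<delta>_def n_def by linarith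
  also have "\<psi> (to_completion g) \<le> (\<Sum>v | tp_fun g v \<noteq> 0. if tp_fun g v > 0 then 2 * B * tp_fun g v else 0)"
    unfolding \<psi>(2) tp_pair_def
  proof (rule sum_mono)
    fix v
    show "tp_fun g v * l v \<le> (if tp_fun g v > 0 then 2 * B * tp_fun g v else 0)"
      using mult_left_mono[OF l_bd(2)[of v], of "tp_fun g v"] mult_nonpos_nonneg[OF _ l_bd(1)[of v], of "tp_fun g v"]
      by (auto simp: mult.commute not_less)
  qed
  also have "\<dots> = 2 * B * (\<Sum>v | tp_fun g v > 0. tp_fun g v)"
    unfolding sum_distrib_left
    by (rule sum.mono_neutral_cong_right) (auto simp: finite_supp_tp)
  finally have "n / (8 * B) < (\<Sum>v | tp_fun g v > 0. tp_fun g v)"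
    using B by (simp add: field_simps)
  hence "s * (n / (8 * B)) < s * (\<Sum>v | tp_fun g v > 0. tp_fun g v)"
    using s by (rule mult_strict_left_mono)
  thus ?thesis using g unfolding \<delta>_def by (intro exI[of _ g]) linarith
qed

text \<open>If no such pair existed, some norming \<open>l\<close> would have a gap \<open>c\<close> on all pairs from the positive set \<open>P\<close>
to the negative set \<open>N\<close> of a finitely supported approximation. The smallest Lipschitz function \<open>L \<ge> l\<close>
that raises \<open>l\<close> by \<open>c\<close> on \<open>P\<close> still agrees with \<open>l\<close> on \<open>N\<close>, so it exceeds the norm.\<close>

lemma exists_norming_pair:
  fixes f :: "'a::metric_space tc"
  assumes s: "s > 0" and sep: "\<And>x y :: 'a. x \<noteq> y \<Longrightarrow> s \<le> dist x y"
    and f: "f \<noteq> 0" and \<phi>0: "\<phi>0 \<in> dual_ball" "\<phi>0 f = norm f"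
  shows "\<exists>x y. x \<noteq> y \<and> (\<forall>\<phi>\<in>dual_ball. \<phi> f = norm f \<longrightarrow> \<phi> (to_completion (atom x y)) = dist x y)"
proof (rule ccontr)
  assume no: "\<not> ?thesis"
  obtain g where g: "norm (f - to_completion g) < s * (\<Sum>v | tp_fun g v > 0. tp_fun g v)"
    using tp_positive_mass_ge[OF f \<phi>0 s] by blast
  define P where "P = {v. tp_fun g v > 0}"
  define N where "N = {v. tp_fun g v < 0}"
  have fin: "finite P" "finite N"
    by (auto simp: P_def N_def intro: finite_subset[OF _ finite_supp_tp[of g]])
  have gap: "\<exists>\<phi>\<in>dual_ball. \<phi> f = norm f \<and> \<phi> (to_completion (atom x y)) \<noteq> dist x y"
    if "(x, y) \<in> P \<times> N" for x y
  proof -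
    have "x \<noteq> y" using that by (auto simp: P_def N_def)
    thus ?thesis using no by blast
  qed
  obtain \<phi> c where \<phi>: "\<phi> \<in> dual_ball" "\<phi> f = norm f" and c: "c > 0"
    and \<phi>gap: "\<And>x y. x \<in> P \<Longrightarrow> y \<in> N \<Longrightarrow> \<phi> (to_completion (atom x y)) \<le> dist x y - c"
    using dual_ball_uniform_gap[OF finite_cartesian_product[OF fin] \<phi>0 gap] by force
  define l where "l v = \<phi> (to_completion (atom v undefined))" for v
  have l_diff: "l x - l y = \<phi> (to_completion (atom x y))" for x y
    unfolding l_def by (rule dual_ball_atom_diff[OF \<phi>(1), symmetric])
  have lip: "l x - l y \<le> dist x y" for x y using dual_ball_atom_le[OF \<phi>(1), of x y] by (simp add: l_diff)
  \<comment> \<open>The maximum over \<open>E w\<close> is the least 1-Lipschitz majorant of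
    \<open>l\<close> that is at least \<open>l + c\<close> on \<open>P\<close>.\<close>
  define E where "E w = insert (l w) ((\<lambda>x. l x + c - dist x w) ` P)" for w
  have E: "finite (E w)" "E w \<noteq> {}" for w using fin by (auto simp: E_def)
  define L where "L w = Max (E w)" for w
  have L_ge: "l w \<le> L w" "x \<in> P \<Longrightarrow> l x + c - dist x w \<le> L w" for w x
    unfolding L_def using E by (auto intro!: Max_ge simp: E_def)
  have L_le: "L w \<le> b" if "l w \<le> b" "\<And>x. x \<in> P \<Longrightarrow> l x + c - dist x w \<le> b" for w b
    unfolding L_def using E that by (auto simp: Max_le_iff E_def)
  have L_lip: "L u - L v \<le> dist u v" for u v
  proof -
    have "L u \<le> L v + dist u v"
    proof (rule L_le)
      show "l u \<le> L v + dist u v" using lip[of u v] L_ge(1)[of v] by linarith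
      show "l x + c - dist x u \<le> L v + dist u v" if "x \<in> P" for x
        using L_ge(2)[OF that, of v] dist_triangle[of x v u] by linarith
    qed
    thus ?thesis by simp
  qed
  define D where "D v = L v - l v" for v
  have D0: "0 \<le> D v" for v using L_ge(1) by (simp add: D_def)
  have Dc: "D v \<le> c" for v
  proof -
    have "L v \<le> l v + c" by (rule L_le) (use c lip[of _ v] in \<open>auto simp: algebra_simps\<close>)
    thus ?thesis by (simp add: D_def)
  qed
  have DP: "D v = c" if "v \<in> P" for v
    using L_ge(2)[OF that, of v] Dc[of v] by (simp add: D_def)
  have DN: "D v = 0" if "v \<in> N" for v
  proof -
    have "L v \<le> l v"
    proof (rule L_le)
      show "l x + c - dist x v \<le> l v" if "x \<in> P" for x
        using \<phi>gap[OF that \<open>v \<in> N\<close>] l_diff[of x v] by linarith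
    qed simp
    thus ?thesis using D0[of v] by (simp add: D_def)
  qed
  \<comment> \<open>Uniform discreteness enters here: values in \<open>[0, c]\<close> at points at
    least \<open>s\<close> apart have Lipschitz constant \<open>c / s\<close>.\<close>
  have D_lip: "D u - D v \<le> c / s * dist u v" for u v
  proof (cases "u = v")
    case False
    have "D u - D v \<le> c / s * s" using D0[of v] Dc[of u] s by simp
    also have "\<dots> \<le> c / s * dist u v" using sep[OF False] c s by (intro mult_left_mono) auto
    finally show ?thesis .
  qed simp
  obtain \<psi> where \<psi>: "\<psi> \<in> dual_ball" "\<And>g. \<psi> (to_completion g) = tp_pair g L"
    using dual_ball_of_lipschitz[of L] L_lip by blast
  have pair: "\<psi> (to_completion h) - \<phi> (to_completion h) = tp_pair h D" for h
    unfolding \<psi>(2) dual_ball_eq_tp_pair[OF \<phi>(1), of h undefined] D_def tp_pair_diff_right l_def ..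
  have diff_le: "\<bar>\<psi> z - \<phi> z\<bar> \<le> c / s * norm z" for z
  proof (rule completion_closed_induct[of "\<lambda>z. \<bar>\<psi> z - \<phi> z\<bar> \<le> c / s * norm z"])
    show "closed {z. \<bar>\<psi> z - \<phi> z\<bar> \<le> c / s * norm z}"
      using linear_continuous_on[OF dual_ball_bounded_linear[OF \<psi>(1)]]
        linear_continuous_on[OF dual_ball_bounded_linear[OF \<phi>(1)]]
      by (intro closed_Collect_le continuous_intros)
    show "\<bar>\<psi> (to_completion h) - \<phi> (to_completion h)\<bar> \<le> c / s * norm (to_completion h)" for h
      unfolding pair norm_to_completion
      by (rule tp_pair_abs_le_lipschitz[OF _ D_lip]) (use c s in simp)
  qed
  have D_eq: "tp_fun g v * D v = (if tp_fun g v > 0 then tp_fun g v * c else 0)" for v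
    using DP[of v] DN[of v] by (cases "tp_fun g v" "0 :: real" rule: linorder_cases) (auto simp: P_def N_def)
  have "tp_pair g D = (\<Sum>v | tp_fun g v > 0. tp_fun g v * c)"
    unfolding tp_pair_def D_eq
    by (rule sum.mono_neutral_cong_right) (auto simp: finite_supp_tp)
  \<comment> \<open>The gain on \<open>g\<close> is \<open>c\<close> times its positive mass. As
    \<open>\<psi>\<close> cannot exceed \<open>\<phi>\<close> at \<open>f\<close>, the approximation
    error would have to pay for it, and it is too small.\<close>
  hence "c * (\<Sum>v | tp_fun g v > 0. tp_fun g v) = \<psi> (to_completion g) - \<phi> (to_completion g)"
    by (simp add: pair sum_distrib_left mult.commute)
  also have "\<dots> \<le> \<phi> (f - to_completion g) - \<psi> (f - to_completion g)"
    using dual_ball_le[OF \<psi>(1), of f] \<phi>(2)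
    by (simp add: linear_diff[OF dual_ball_linear[OF \<phi>(1)]] linear_diff[OF dual_ball_linear[OF \<psi>(1)]])
  also have "\<dots> \<le> c / s * norm (f - to_completion g)"
    using diff_le[of "f - to_completion g"] by linarith
  also have "\<dots> < c / s * (s * (\<Sum>v | tp_fun g v > 0. tp_fun g v))"
    using g c s by (intro mult_strict_left_mono) auto
  finally show False using s by simp
qed

section \<open>Transfer from a copy of \<open>ell1\<close> to norming pairs\<close>

theorem theorem1p3:
  assumes "\<exists>L :: 'a::metric_space tc set. subspace L \<and> isometric_to_ell1 L"
  shows "\<exists>L :: 'a tc set. subspace L \<and> closed L \<and> isometric_to_ell1 L \<and>
    (\<exists>P :: 'a tc \<Rightarrow> 'a tc. bounded_linear P \<and> P \<circ> P = P \<and> range P = L \<and> onorm P = 1)"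
proof -
  obtain T :: "ell1 \<Rightarrow> 'a tc" where T: "linear T" and normT: "\<And>x. norm (T x) = norm x"
    using assms by (auto simp: isometric_to_ell1_def)
  have "\<exists>(x :: nat \<Rightarrow> 'a) y p q. ball_packing x y p q"
  proof (cases "\<exists>s>0. \<forall>x y :: 'a. x \<noteq> y \<longrightarrow> s \<le> dist x y")
    case False
    show ?thesis
      by (rule ball_packing_if_not_uniformly_discrete) (use False in \<open>auto simp: not_le\<close>)
  next
    case True
    then obtain s where s: "s > 0" "\<And>x y :: 'a. x \<noteq> y \<Longrightarrow> s \<le> dist x y" by blast
    define e where "e n = Abs_ell1 (\<lambda>k. if k = n then 1 else 0)" for n
    have "summable (\<lambda>k. \<bar>if k = n then 1 else 0 :: real\<bar>)" for n :: nat
      by (rule summable_finite[of "{n}"]) auto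
    hence e: "ell1_seq (e n) = (\<lambda>k. if k = n then 1 else 0)" for n
      by (simp add: e_def Abs_ell1_inverse)
    have norm_e: "norm (e n) = 1" for n
    proof -
      have "(\<lambda>k. if k = n then 1 else 0 :: real) sums 1"
        using sums_If_finite_set[of "{n}" "\<lambda>_. 1 :: real"] by simp
      moreover have "(\<lambda>k. \<bar>ell1_seq (e n) k\<bar>) = (\<lambda>k. if k = n then 1 else 0)" by (auto simp: e)
      ultimately show ?thesis by (simp add: norm_ell1.rep_eq sums_iff)
    qed
    have injT: "inj T" unfolding linear_injective_0[OF T] by (metis normT norm_eq_zero)
    \<comment> \<open>A bounded sign sequence acts on \<open>ell1\<close> with norm at most 1; the
      action is carried over by \<open>T\<close> and extended by Hahn-Banach.\<close>
    have signs: "\<exists>\<phi>\<in>dual_ball. \<forall>n. \<phi> (T (e n)) = \<theta> n" if \<theta>: "range \<theta> \<subseteq> {1, -1}" for \<theta> :: "nat \<Rightarrow> real"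
    proof -
      have abs\<theta>: "\<bar>\<theta> k\<bar> = 1" for k using \<theta> by (metis UNIV_I abs_1 abs_minus image_subset_iff insertE singletonD)
      have abs_sum: "summable (\<lambda>k. \<bar>\<theta> k * ell1_seq x k\<bar>)" for x
        using summable_ell1[of x] by (simp add: abs_mult abs\<theta>)
      note sum = summable_rabs_cancel[OF abs_sum]
      define \<phi> where "\<phi> x = (\<Sum>k. \<theta> k * ell1_seq x k)" for x
      have "\<exists>\<psi>\<in>dual_ball. \<forall>z\<in>range T. \<psi> z = \<phi> (inv T z)"
      proof (rule hahn_banach_dual_ball)
        show "subspace (range T)" by (rule linear_subspace_image[OF T subspace_UNIV])
      next
        fix z w assume "z \<in> range T" "w \<in> range T"
        then obtain a b where "z = T a" "w = T b" by blast
        moreover have "\<phi> (a + b) = \<phi> a + \<phi> b"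
          unfolding \<phi>_def suminf_add[OF sum sum] by (simp add: plus_ell1.rep_eq distrib_left)
        ultimately show "\<phi> (inv T (z + w)) = \<phi> (inv T z) + \<phi> (inv T w)"
          by (simp add: inv_f_f[OF injT] flip: linear_add[OF T])
      next
        fix c z assume "z \<in> range T"
        then obtain a where "z = T a" by blast
        moreover have "\<phi> (c *\<^sub>R a) = c * \<phi> a"
          unfolding \<phi>_def suminf_mult[OF sum, symmetric] by (simp add: scaleR_ell1.rep_eq mult.left_commute)
        ultimately show "\<phi> (inv T (c *\<^sub>R z)) = c * \<phi> (inv T z)"
          by (simp add: inv_f_f[OF injT] flip: linear_scale[OF T])
      next
        fix z assume "z \<in> range T"
        then obtain a where a: "z = T a" by blast
        have "\<phi> a \<le> (\<Sum>k. \<bar>\<theta> k * ell1_seq a k\<bar>)"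
          unfolding \<phi>_def by (rule suminf_le[OF _ sum abs_sum]) simp
        also have "\<dots> = norm a" by (simp add: norm_ell1.rep_eq abs_mult abs\<theta>)
        finally show "\<phi> (inv T z) \<le> norm z" by (simp add: a inv_f_f[OF injT] normT)
      qed
      then obtain \<psi> where \<psi>: "\<psi> \<in> dual_ball" "\<And>x. \<psi> (T x) = \<phi> x"
        by (auto simp: inv_f_f[OF injT])
      have "\<phi> (e n) = \<theta> n" for n
        using sums_If_finite_set[of "{n}" \<theta>] by (simp add: \<phi>_def e sums_iff if_distrib cong: if_cong)
      thus ?thesis using \<psi> by (intro bexI[of _ \<psi>]) simp_all
    qed
    have "\<exists>x y. x \<noteq> y \<and> (\<forall>\<phi>\<in>dual_ball. \<phi> (T (e n)) = 1 \<longrightarrow> \<phi> (to_completion (atom x y)) = dist x y)" for n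
    proof -
      obtain \<phi> where \<phi>: "\<phi> \<in> dual_ball" "\<phi> (T (e n)) = 1" using signs[of "\<lambda>_. 1"] by auto
      have 1: "norm (T (e n)) = 1" by (simp add: normT norm_e)
      hence "T (e n) \<noteq> 0" by auto
      from exists_norming_pair[OF s this \<phi>(1)] \<phi>(2) show ?thesis unfolding 1 by blast
    qed
    then obtain x y where ne: "\<And>n. x n \<noteq> y n"
      and xy: "\<And>n \<phi>. \<phi> \<in> dual_ball \<Longrightarrow> \<phi> (T (e n)) = 1 \<Longrightarrow> \<phi> (to_completion (atom (x n) (y n))) = dist (x n) (y n)"
      by metis
    have "sign_free x y"
      unfolding sign_free_def
    proof (intro allI impI)
      fix \<theta> :: "nat \<Rightarrow> real" assume \<theta>: "range \<theta> \<subseteq> {1, -1}"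
      then obtain \<phi> where \<phi>: "\<phi> \<in> dual_ball" "\<And>n. \<phi> (T (e n)) = \<theta> n" using signs by blast
      define l where "l v = \<phi> (to_completion (atom v undefined))" for v
      have l: "l u - l v = \<phi> (to_completion (atom u v))" for u v
        unfolding l_def by (rule dual_ball_atom_diff[OF \<phi>(1), symmetric])
      have "\<phi> (to_completion (atom (x n) (y n))) = \<theta> n * dist (x n) (y n)" for n
      proof -
        have "\<theta> n = 1 \<or> \<theta> n = -1" using \<theta> by blast
        \<comment> \<open>At sign -1 it is the negative of \<open>\<phi>\<close> that norms
          \<open>T (e n)\<close>, so the pair is extremal for it and the sign carries over.\<close>
        thus ?thesis
          using xy[OF \<phi>(1), of n] xy[OF dual_ball_uminus[OF \<phi>(1)], of n] \<phi>(2)[of n] by auto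
      qed
      thus "\<exists>l. (\<forall>u v. l u - l v \<le> dist u v) \<and> (\<forall>n. l (x n) - l (y n) = \<theta> n * dist (x n) (y n))"
        using dual_ball_atom_le[OF \<phi>(1)] l by (intro exI[of _ l]) simp
    qed
    with ne show ?thesis by (rule ball_packing_if_sign_free)
  qed
  thus ?thesis using complemented_ell1_if_ball_packing by blast
qed

end
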